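(* Let $a>0$ and let $n\ge 1$ be a fixed odd integer. There is $\Lambda>0$ (depending on $a$ and $n$) such that for all $\lambda\ge\Lambda$ with $1\le n<n_\lambda$ the following holds. Put $\delta=\tfrac12\left(\operatorname{Re}z_n-\operatorname{Re}z_{n-1}\right)$. For every $x\in[-a,a]$ the Laurent expansion in $k$ about $z_n$, $$e^{ika}\phi(k,x)=\frac{a_{-1}(x)}{k-z_n}+a_0(x)+R_0(k,x),\qquad R_0(k,x)=\sum_{m\ge1}a_m(x)(k-z_n)^m,$$ converges for all $k\in[\operatorname{Re}z_n-\delta,\operatorname{Re}z_n+\delta]$. Moreover, as $\lambda\to\infty$: for every integer $m\ge-1$ there is a constant $C_m$ independent of $\lambda$ such that $\sup_{|x|\le a}|a_m(x)|\le C_m\lambda^{m/2}$ for all sufficiently large $\lambda$; and there is a constant $C$ independent of $\lambda$ and $k$ such that, for all sufficiently large $\lambda$, $$\sup_{|x|\le a}|R_0(k,x)|\le C\,\lambda^{1/2}\,|k-z_n|\qquad\text{for all }k\in[\operatorname{Re}z_n-\delta,\operatorname{Re}z_n+\delta].$$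
   Context: Fix $a>0$; for $\lambda>0$ let $V_\lambda=\lambda\chi_{[-a,a]}$ and $H_\lambda=-\frac12\frac{d^2}{dx^2}+V_\lambda$ on $L^2(\mathbb R)$. Square roots and logarithms are principal branches. For $k$ write $\tilde k=\sqrt{k^2-2\lambda}$. Symmetric generalized eigenfunctions: for $|x|\le a$, $\phi(k,x)=\frac{e^{-ika}}{\sqrt\pi\,F(k)}\cos(\tilde kx)$, where $F(k)=\cos\tilde ka-i\frac{\tilde k}{k}\sin\tilde ka$. Here $F$ and $\cos(\tilde kx)$ are even in $\tilde k$, so $\phi(\cdot,x)$ continues meromorphically to complex $k\neq0$. Resonances: for an integer $n\ge1$, the resonance $z_n$ is the complex number with $\operatorname{Re}z_n>0$, $\operatorname{Im}z_n<0$ such that, with $\tilde z_n=\sqrt{z_n^2-2\lambda}$, the number $\tilde\kappa=\tilde z_n/\sqrt{2\lambda}$ satisfies $$\tilde\kappa=\frac{n\pi}{2a\sqrt{2\lambda}}-\frac{i}{a\sqrt{2\lambda}}\ln\!\left(\tilde\kappa+\sqrt{\tilde\kappa^2+1}\right).$$ By convention $z_0=\sqrt{2\lambda}$ (the solution $\tilde\kappa=0$ for $n=0$). Finally $n_\lambda=\sqrt{\lambda/2-\sqrt{2\lambda}}$. *)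

theory Defs
  imports "HOL-Complex_Analysis.Complex_Analysis"
begin

text \<open>Potential barrier \<open>V = \<lambda> \<chi>\<^bsub>[-a,a]\<^esub>\<close> with Hamiltonian \<open>-(1/2) d\<^sup>2/dx\<^sup>2 + V\<close>.
  All square roots and logarithms are principal branches (\<open>csqrt\<close>, \<open>Ln\<close>).\<close>

definition ktilde :: "real \<Rightarrow> complex \<Rightarrow> complex" where
  "ktilde lam k = csqrt (k\<^sup>2 - 2 * of_real lam)"

definition F :: "real \<Rightarrow> real \<Rightarrow> complex \<Rightarrow> complex" where
  "F a lam k = cos (ktilde lam k * of_real a)
     - \<i> * (ktilde lam k / k) * sin (ktilde lam k * of_real a)"

text \<open>The symmetric generalized eigenfunction inside the barrier, \<open>\<bar>x\<bar> \<le> a\<close>. \<open>F\<close> and the cosine are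
  even in \<open>ktilde\<close>, so the branch cut of the square root is invisible and the formula is
  meromorphic in \<open>k \<noteq> 0\<close>, with poles at the zeros of \<open>F\<close> (where HOL's division gives 0).\<close>

definition phi :: "real \<Rightarrow> real \<Rightarrow> complex \<Rightarrow> real \<Rightarrow> complex" where
  "phi a lam k x = exp (- \<i> * k * of_real a) / (of_real (sqrt pi) * F a lam k)
     * cos (ktilde lam k * of_real x)"

definition is_resonance :: "real \<Rightarrow> real \<Rightarrow> nat \<Rightarrow> complex \<Rightarrow> bool" where
  "is_resonance a lam n z \<longleftrightarrow> Re z > 0 \<and> Im z < 0 \<and>
     (let \<beta> = sqrt (2 * lam); \<kappa> = ktilde lam z / of_real \<beta> in
        \<kappa> = of_real (real n * pi / (2 * a * \<beta>))
              - \<i> / of_real (a * \<beta>) * Ln (\<kappa> + csqrt (\<kappa>\<^sup>2 + 1)))"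

text \<open>Since \<open>resonance\<close> is a definite description, any result about it entails existence
  and uniqueness of the solution, which hold for \<open>lam\<close> large compared with \<open>n\<close> and \<open>1/a\<close>.\<close>

definition resonance :: "real \<Rightarrow> real \<Rightarrow> nat \<Rightarrow> complex" where
  "resonance a lam n =
     (if n = 0 then of_real (sqrt (2 * lam)) else (THE z. is_resonance a lam n z))"

definition n_max :: "real \<Rightarrow> real" where
  "n_max lam = sqrt (lam / 2 - sqrt (2 * lam))"

definition half_gap :: "real \<Rightarrow> real \<Rightarrow> nat \<Rightarrow> real" where
  "half_gap a lam n = (Re (resonance a lam n) - Re (resonance a lam (n - 1))) / 2"

definition window :: "real \<Rightarrow> real \<Rightarrow> nat \<Rightarrow> real set" where
  "window a lam n = {Re (resonance a lam n) - half_gap a lam n ..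
                     Re (resonance a lam n) + half_gap a lam n}"

definition phase_phi :: "real \<Rightarrow> real \<Rightarrow> real \<Rightarrow> complex \<Rightarrow> complex" where
  "phase_phi a lam x k = exp (\<i> * k * of_real a) * phi a lam k x"

definition laurent_series :: "real \<Rightarrow> real \<Rightarrow> nat \<Rightarrow> real \<Rightarrow> complex fls" where
  "laurent_series a lam n x = laurent_expansion (phase_phi a lam x) (resonance a lam n)"

definition laurent_coeff :: "real \<Rightarrow> real \<Rightarrow> nat \<Rightarrow> int \<Rightarrow> real \<Rightarrow> complex" where
  "laurent_coeff a lam n m x = fls_nth (laurent_series a lam n x) m"

text \<open>The series over \<open>m \<ge> 1\<close>, written with the index shifted to start at 0.\<close>

definition R0_term :: "real \<Rightarrow> real \<Rightarrow> nat \<Rightarrow> complex \<Rightarrow> real \<Rightarrow> nat \<Rightarrow> complex" where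
  "R0_term a lam n k x j =
     laurent_coeff a lam n (int (Suc j)) x * (k - resonance a lam n) ^ Suc j"

definition R0 :: "real \<Rightarrow> real \<Rightarrow> nat \<Rightarrow> complex \<Rightarrow> real \<Rightarrow> complex" where
  "R0 a lam n k x = (\<Sum>j. R0_term a lam n k x j)"

end

theory Submission
  imports Defs
begin

text \<open>
  Put \<open>b = sqrt (2 * lam)\<close> and \<open>u = b * (k - b)\<close>. In the variable \<open>u\<close> the function \<open>F\<close> depends on \<open>lam\<close> only
  through \<open>e = 1 / b\<close>, and as \<open>e\<close> tends to 0 it converges, uniformly on compact sets, to
  \<open>cos (a * csqrt (2 * u))\<close>, whose zeros \<open>j^2 * pi^2 / (8 * a^2)\<close> (\<open>j\<close> odd) are simple and do not depend
  on \<open>lam\<close>. The rescaled resonance is the zero of \<open>F\<close> that converges to the one with \<open>j = n\<close>. Dividing it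
  out leaves a function bounded away from 0, so that in the variable \<open>u\<close> the numerator of the pole
  is bounded on a fixed disc, uniformly in \<open>lam\<close> and \<open>x\<close>. Cauchy's inequalities bound the Laurent
  coefficients, and undoing the scaling turns the coefficient of index \<open>m\<close> into one of order \<open>b^m\<close>.
  The rescaled window has half width close to \<open>(2 * n - 1) * pi^2 / (16 * a^2)\<close>, well inside the disc of
  radius \<open>n * pi^2 / (4 * a^2)\<close>, in which \<open>j = n\<close> gives the only zero.
\<close>

section \<open>Complex analysis\<close>

text \<open>Off the closed negative half-line \<open>csqrt\<close> itself is holomorphic. Off the
  closed positive half-line it equals \<i> * \<open>csqrt (- z)\<close> up to a sign, which an even
  function does not see. These two domains cover all points but 0, where continuity removes the
  singularity.\<close>

lemma holomorphic_even_comp_csqrt: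
  assumes g: "g holomorphic_on UNIV" and even: "\<And>w. g (- w) = g w"
  shows "(\<lambda>z. g (csqrt z)) holomorphic_on UNIV"
proof (rule no_isolated_singularity)
  have csqrt': "csqrt z = \<i> * csqrt (- z) \<or> csqrt z = - (\<i> * csqrt (- z))" for z
  proof -
    have "(csqrt z)\<^sup>2 = (\<i> * csqrt (- z))\<^sup>2" by (simp add: power_mult_distrib del: csqrt.simps)
    then show ?thesis using power2_eq_iff by blast
  qed
  have "(\<lambda>z. g (csqrt z)) holomorphic_on - \<real>\<^sub>\<le>\<^sub>0"
    by (rule holomorphic_on_compose_gen[OF holomorphic_on_csqrt g, unfolded o_def]) auto
  moreover have "(\<lambda>z. g (csqrt z)) holomorphic_on uminus ` (- \<real>\<^sub>\<le>\<^sub>0)"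
  proof -
    have "(\<lambda>z. g (\<i> * csqrt (- z))) holomorphic_on uminus ` (- \<real>\<^sub>\<le>\<^sub>0)"
      by (rule holomorphic_on_compose_gen[of "\<lambda>z. \<i> * csqrt (- z)" _ g UNIV, unfolded o_def])
         (auto intro!: holomorphic_intros g)
    moreover have "g (\<i> * csqrt (- z)) = g (csqrt z)" for z
      using csqrt'[of z] even by metis
    ultimately show ?thesis by simp
  qed
  moreover have "open (uminus ` (- \<real>\<^sub>\<le>\<^sub>0 :: complex set))"
    by (intro open_negations) (simp add: open_Compl)
  ultimately have "(\<lambda>z. g (csqrt z)) holomorphic_on (- \<real>\<^sub>\<le>\<^sub>0 \<union> uminus ` (- \<real>\<^sub>\<le>\<^sub>0))"
    by (simp add: holomorphic_on_Un open_Compl)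
  moreover have "- \<real>\<^sub>\<le>\<^sub>0 \<union> uminus ` (- \<real>\<^sub>\<le>\<^sub>0) = (UNIV - {0::complex})"
  proof (intro equalityI subsetI)
    fix z :: complex assume "z \<in> UNIV - {0}"
    then have "z \<notin> \<real>\<^sub>\<le>\<^sub>0 \<or> - z \<notin> \<real>\<^sub>\<le>\<^sub>0"
      by (auto simp: complex_nonpos_Reals_iff complex_eq_iff)
    then show "z \<in> - \<real>\<^sub>\<le>\<^sub>0 \<union> uminus ` (- \<real>\<^sub>\<le>\<^sub>0)"
      by (auto simp: image_iff intro!: bexI[of _ "- z"])
  qed auto
  ultimately show holo: "(\<lambda>z. g (csqrt z)) holomorphic_on UNIV - {0}" by simp
  have "isCont (\<lambda>z. g (csqrt z)) z" for z
  proof (cases "z = 0")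
    case True
    have "((\<lambda>z. norm (csqrt z)) \<longlongrightarrow> sqrt (norm (0::complex))) (at 0)"
      unfolding norm_csqrt by (intro tendsto_intros)
    then have "((\<lambda>z. norm (csqrt z)) \<longlongrightarrow> 0) (at 0)"
      by (simp only: norm_zero real_sqrt_zero)
    then have "(csqrt \<longlongrightarrow> 0) (at 0)"
      by (rule tendsto_norm_zero_cancel)
    moreover have "isCont g 0"
      using continuous_on_interior[OF holomorphic_on_imp_continuous_on[OF g], of 0] by simp
    ultimately have "((\<lambda>z. g (csqrt z)) \<longlongrightarrow> g 0) (at 0)"
      by (rule isCont_tendsto_compose[rotated])
    then show ?thesis by (simp add: True isCont_def)
  next
    case False
    then show ?thesis
      using continuous_on_interior[OF holomorphic_on_imp_continuous_on[OF holo], of z]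
      by (simp add: interior_open open_delete)
  qed
  then show "continuous_on UNIV (\<lambda>z. g (csqrt z))"
    by (simp add: continuous_on_eq_continuous_at)
qed auto

text \<open>After division by their zeros, the quotients of \<open>G i\<close> stay close to the
  quotient of the limit \<open>g\<close>, which is bounded away from 0 on the disc because its only
  zero there, \<open>c\<close>, is simple. Thus \<open>q\<close> is uniform in
  \<open>i\<close>.\<close>

lemma simple_zero_factorization:
  fixes G :: "'i \<Rightarrow> complex \<Rightarrow> complex"
  assumes R: "0 < R" and S: "open S" "cball c R \<subseteq> S"
    and lim: "uniform_limit (cball c R) G g I"
    and G: "\<forall>\<^sub>F i in I. G i holomorphic_on S" and g: "g holomorphic_on S"
    and gz: "g c = 0" "deriv g c \<noteq> 0" "\<forall>u\<in>cball c R. g u = 0 \<longrightarrow> u = c"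
    and \<zeta>: "(\<zeta> \<longlongrightarrow> c) I" "\<forall>\<^sub>F i in I. G i (\<zeta> i) = 0"
  obtains q where "q > 0"
    "\<forall>\<^sub>F i in I. \<exists>Q. Q holomorphic_on S \<and> (\<forall>u. G i u = (u - \<zeta> i) * Q u) \<and>
       (\<forall>u\<in>cball c R. q \<le> cmod (Q u))"
proof -
  \<comment> \<open>The difference quotient with its removable singularity filled by the
    derivative.\<close>
  define D where "D = (\<lambda>(f :: complex \<Rightarrow> complex) w u. if u = w then deriv f w else (f u - f w) / (u - w))"
  have D_holo: "D f w holomorphic_on S" if "f holomorphic_on S" for f w
    unfolding D_def using pole_lemma_open[OF that S(1)] .
  define Q0 where "Q0 = D g c"
  have "continuous_on (cball c R) (\<lambda>u. cmod (Q0 u))"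
    using D_holo[OF g] S(2) unfolding Q0_def
    by (intro continuous_intros holomorphic_on_imp_continuous_on) (rule holomorphic_on_subset)
  then obtain u0 where u0: "u0 \<in> cball c R" "\<And>u. u \<in> cball c R \<Longrightarrow> cmod (Q0 u0) \<le> cmod (Q0 u)"
    using continuous_attains_inf[of "cball c R" "\<lambda>u. cmod (Q0 u)"] R by auto
  have "Q0 u0 \<noteq> 0"
    using gz u0(1) by (auto simp: Q0_def D_def)
  \<comment> \<open>Half the minimum of the limit quotient: a perturbation of size at most
    \<open>q\<close> leaves at least \<open>q\<close>.\<close>
  define q where "q = cmod (Q0 u0) / 2"
  have q: "q > 0" using \<open>Q0 u0 \<noteq> 0\<close> by (simp add: q_def)
  have "bounded (g ` cball c R)"
    using g S(2) by (intro compact_imp_bounded compact_continuous_image holomorphic_on_imp_continuous_on)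
      (auto intro: holomorphic_on_subset)
  then obtain B where B: "B > 0" "\<And>u. u \<in> cball c R \<Longrightarrow> cmod (g u) \<le> B"
    by (auto simp: bounded_pos)
  \<comment> \<open>\<open>e1\<close> and the second entry of \<open>e2\<close> make each of the two
    error terms on the boundary circle at most \<open>q / 2\<close>. The entry \<open>R / 2\<close>
    keeps the moving zero at distance at least \<open>R / 2\<close> from that circle.\<close>
  define e1 where "e1 = q * R / 4"
  define e2 where "e2 = min (R / 2) (q * R\<^sup>2 / (4 * B))"
  have e: "e1 > 0" "e2 > 0" using q R B(1) by (auto simp: e1_def e2_def)
  have "\<forall>\<^sub>F i in I. \<forall>u\<in>cball c R. dist (G i u) (g u) < e1"
    using uniform_limitD[OF lim e(1)] .
  moreover have "\<forall>\<^sub>F i in I. dist (\<zeta> i) c < e2"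
    using tendstoD[OF \<zeta>(1) e(2)] .
  ultimately have "\<forall>\<^sub>F i in I. \<exists>Q. Q holomorphic_on S \<and> (\<forall>u. G i u = (u - \<zeta> i) * Q u) \<and>
       (\<forall>u\<in>cball c R. q \<le> cmod (Q u))"
    using G \<zeta>(2)
  proof eventually_elim
    case (elim i)
    define w where "w = \<zeta> i"
    have w: "cmod (w - c) < R / 2" "cmod (w - c) < q * R\<^sup>2 / (4 * B)" "G i w = 0"
      using elim by (auto simp: w_def e2_def dist_norm)
    define Q where "Q = D (G i) w"
    have Qh: "Q holomorphic_on S" unfolding Q_def using D_holo[OF elim(3)] .
    \<comment> \<open>\<open>Q\<close> is close to \<open>Q0\<close> on the boundary circle, hence in the disc by the maximum principle.\<close>
    have frontier_le: "cmod (Q u - Q0 u) \<le> q" if "u \<in> frontier (cball c R)" for u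
    proof -
      have uc: "cmod (u - c) = R" using that R by (simp add: dist_norm norm_minus_commute)
      then have uw: "R / 2 \<le> cmod (u - w)"
        using norm_triangle_ineq2[of "u - c" "w - c"] w(1) by simp
      have ne: "u \<noteq> c" "u \<noteq> w" using uc uw R by auto
      have u: "u \<in> cball c R" using uc by (simp add: dist_norm norm_minus_commute)
      \<comment> \<open>Both zeros drop out of the numerators. The first term measures the change of
        the function, the second the displacement of the zero.\<close>
      have "Q u - Q0 u = (G i u - g u) / (u - w) + g u * (w - c) / ((u - w) * (u - c))"
        using ne w(3) gz(1) by (simp add: Q_def Q0_def D_def divide_simps) (simp add: algebra_simps)
      also have "cmod \<dots> \<le> cmod (G i u - g u) / cmod (u - w) +
          cmod (g u) * cmod (w - c) / (cmod (u - w) * R)"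
        using uc by (intro order_trans[OF norm_triangle_ineq]) (simp add: norm_divide norm_mult)
      also have "\<dots> \<le> e1 / (R / 2) + B * (q * R\<^sup>2 / (4 * B)) / ((R / 2) * R)"
        using elim(1) u uw w(2) B R q e
        by (intro add_mono frac_le mult_mono mult_nonneg_nonneg mult_pos_pos)
          (auto simp: dist_norm less_imp_le)
      also have "\<dots> = q"
        using R B by (simp add: e1_def field_simps power2_eq_square)
      finally show ?thesis .
    qed
    have "q \<le> cmod (Q u)" if u: "u \<in> cball c R" for u
    proof -
      have hd: "(\<lambda>u. Q u - Q0 u) holomorphic_on S"
        using Qh D_holo[OF g] unfolding Q0_def by (intro holomorphic_intros)
      have "cmod (Q u - Q0 u) \<le> q"
      proof (rule maximum_modulus_frontier[of "\<lambda>u. Q u - Q0 u" "cball c R"])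
        show "(\<lambda>u. Q u - Q0 u) holomorphic_on interior (cball c R)"
          using interior_subset S(2) by (intro holomorphic_on_subset[OF hd]) blast
        show "continuous_on (closure (cball c R)) (\<lambda>u. Q u - Q0 u)"
          using S(2) by (intro holomorphic_on_imp_continuous_on holomorphic_on_subset[OF hd]) simp
      qed (use u frontier_le in auto)
      moreover have "2 * q \<le> cmod (Q0 u)" using u0(2)[OF u] by (simp add: q_def)
      ultimately show ?thesis
        using norm_triangle_ineq2[of "Q0 u" "Q u"] by (simp add: norm_minus_commute)
    qed
    moreover have "G i u = (u - w) * Q u" for u
      using w(3) by (simp add: Q_def D_def)
    ultimately show ?case using Qh by (auto simp: w_def)
  qed
  then show thesis using that q by blast
qed

text \<open>The Laurent series of \<open>f\<close> is the Taylor series of \<open>P\<close> shifted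
  by one index. Cauchy's inequalities for \<open>P\<close> bound the coefficients, and a geometric
  series then bounds the tail.\<close>

lemma simple_pole_laurent:
  assumes S: "open S" "cball z r \<subseteq> S" and r: "0 < r" and P: "P holomorphic_on S"
    and bound: "\<forall>k\<in>cball z r. cmod (P k) \<le> B"
    and f: "\<forall>k\<in>cball z r - {z}. f k = P k / (k - z)"
  defines "L \<equiv> laurent_expansion f z"
  shows "(\<lambda>w. f (z + w)) has_laurent_expansion L"
    and "\<And>m. m < - 1 \<Longrightarrow> fls_nth L m = 0"
    and "\<And>j. cmod (fls_nth L (int j - 1)) \<le> B / r ^ j"
    and "\<And>k. k \<in> ball z r \<Longrightarrow> summable (\<lambda>j. fls_nth L (int (Suc j)) * (k - z) ^ Suc j)"
    and "\<And>k. k \<in> ball z r \<Longrightarrow> k \<noteq> z \<Longrightarrow>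
      f k = fls_nth L (- 1) / (k - z) + fls_nth L 0 + (\<Sum>j. fls_nth L (int (Suc j)) * (k - z) ^ Suc j)"
    and "\<And>k. k \<in> ball z r \<Longrightarrow>
      cmod (\<Sum>j. fls_nth L (int (Suc j)) * (k - z) ^ Suc j) \<le> B / r * cmod (k - z) / (r - cmod (k - z))"
proof -
  define p where "p = (\<lambda>j. (deriv ^^ j) P z / fact j)"
  have zS: "z \<in> S" using S(2) r by auto
  then have "P analytic_on {z}" using P S(1) by (auto simp: analytic_at)
  then have "(\<lambda>w. P (z + w)) has_laurent_expansion fps_to_fls (fps_expansion P z)"
    by (intro has_laurent_expansion_fps analytic_at_imp_has_fps_expansion)
  then have "(\<lambda>w. P (z + w) * w powi (- 1)) has_laurent_expansion
      fls_shift 1 (fps_to_fls (fps_expansion P z))"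
    by (rule has_laurent_expansion_shift')
  moreover have "\<forall>\<^sub>F w in at 0. P (z + w) * w powi (- 1) = f (z + w)"
  proof -
    have "\<forall>\<^sub>F w in at 0. w \<in> ball 0 r - {0 :: complex}"
      using r by (intro eventually_at_in_open) auto
    then show ?thesis
      by eventually_elim (simp add: f dist_norm divide_inverse)
  qed
  ultimately have exp: "(\<lambda>w. f (z + w)) has_laurent_expansion
      fls_shift 1 (fps_to_fls (fps_expansion P z))"
    by (simp add: has_laurent_expansion_cong)
  have L: "L = fls_shift 1 (fps_to_fls (fps_expansion P z))"
    unfolding L_def using laurent_expansion_eqI[OF exp] .
  show "(\<lambda>w. f (z + w)) has_laurent_expansion L" using exp L by simp
  show "fls_nth L m = 0" if "m < - 1" for m using that by (simp add: L)
  have nth: "fls_nth L (int j - 1) = p j" for j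
    by (simp add: L p_def fps_expansion_def)
  have p_bound: "cmod (p j) \<le> B / r ^ j" for j
  proof -
    have "cmod ((deriv ^^ j) P z) \<le> fact j * B / r ^ j"
    proof (rule Cauchy_inequality)
      show "P holomorphic_on ball z r"
        using S(2) by (intro holomorphic_on_subset[OF P]) auto
      show "continuous_on (cball z r) P"
        using S(2) by (intro holomorphic_on_imp_continuous_on holomorphic_on_subset[OF P])
    qed (use r bound in \<open>auto simp: dist_norm\<close>)
    then show ?thesis by (simp add: p_def norm_divide field_simps)
  qed
  then show "cmod (fls_nth L (int j - 1)) \<le> B / r ^ j" for j by (simp add: nth)
  \<comment> \<open>One shift comes from the pole, the other from starting the tail at index
    1.\<close>
  have nth': "fls_nth L (int (Suc j)) = p (j + 2)" for j
    using nth[of "j + 2"] by (simp add: add_ac)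
  fix k assume k: "k \<in> ball z r"
  have holo: "P holomorphic_on ball z r"
    using S(2) by (intro holomorphic_on_subset[OF P]) auto
  have sums: "(\<lambda>j. p j * (k - z) ^ j) sums P k"
    using holomorphic_power_series[OF holo k] by (simp add: p_def)
  then have sums2: "(\<lambda>j. p (j + 2) * (k - z) ^ (j + 2)) sums (P k - (p 0 + p 1 * (k - z)))"
    using sums_split_initial_segment[OF sums, of 2] by (simp add: numeral_2_eq_2)
  have eq: "fls_nth L (int (Suc j)) * (k - z) ^ Suc j * (k - z) = p (j + 2) * (k - z) ^ (j + 2)" for j
    unfolding nth' by (simp add: algebra_simps)
  have sums3: "(\<lambda>j. fls_nth L (int (Suc j)) * (k - z) ^ Suc j) sums
      ((P k - (p 0 + p 1 * (k - z))) / (k - z))" if "k \<noteq> z"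
  proof -
    have "(\<lambda>j. p (j + 2) * (k - z) ^ (j + 2) / (k - z)) sums ((P k - (p 0 + p 1 * (k - z))) / (k - z))"
      using sums2 by (rule sums_divide)
    moreover have "p (j + 2) * (k - z) ^ (j + 2) / (k - z) = fls_nth L (int (Suc j)) * (k - z) ^ Suc j" for j
      using that unfolding eq[symmetric] by simp
    ultimately show ?thesis by simp
  qed
  \<comment> \<open>At \<open>k = z\<close> every term vanishes because the exponents start at
    1.\<close>
  show summ: "summable (\<lambda>j. fls_nth L (int (Suc j)) * (k - z) ^ Suc j)"
    using sums3 by (cases "k = z") (auto simp: sums_iff)
  show "f k = fls_nth L (- 1) / (k - z) + fls_nth L 0 + (\<Sum>j. fls_nth L (int (Suc j)) * (k - z) ^ Suc j)"
    if "k \<noteq> z"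
    using bspec[OF f, of k] k that sums_unique[OF sums3[OF that]] nth[of 0] nth[of 1]
    by (simp add: field_simps)
  define t where "t = cmod (k - z)"
  have t: "0 \<le> t" "t < r" using k by (auto simp: t_def dist_norm norm_minus_commute)
  have geo: "(\<lambda>j. B * t / r\<^sup>2 * (t / r) ^ j) sums (B * t / r\<^sup>2 * (1 / (1 - t / r)))"
    using t r by (intro sums_mult geometric_sums) auto
  have "cmod (\<Sum>j. fls_nth L (int (Suc j)) * (k - z) ^ Suc j) \<le> (\<Sum>j. B * t / r\<^sup>2 * (t / r) ^ j)"
  proof (rule norm_suminf_le)
    fix j
    have "cmod (fls_nth L (int (Suc j)) * (k - z) ^ Suc j) \<le> B / r ^ (j + 2) * t ^ Suc j"
      unfolding nth' norm_mult norm_power t_def[symmetric] by (rule mult_right_mono[OF p_bound]) (use t in simp)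
    also have "\<dots> = B * t / r\<^sup>2 * (t / r) ^ j"
      using r by (simp add: field_simps power_add power2_eq_square)
    finally show "cmod (fls_nth L (int (Suc j)) * (k - z) ^ Suc j) \<le> B * t / r\<^sup>2 * (t / r) ^ j" .
  qed (use geo in \<open>simp add: sums_iff\<close>)
  also have "\<dots> = B * t / r\<^sup>2 * (1 / (1 - t / r))" using geo by (simp add: sums_iff)
  also have "\<dots> = B / r * t / (r - t)" using t r by (simp add: field_simps power2_eq_square)
  finally show "cmod (\<Sum>j. fls_nth L (int (Suc j)) * (k - z) ^ Suc j) \<le> B / r * cmod (k - z) / (r - cmod (k - z))"
    by (simp add: t_def)
qed

section \<open>Existence, uniqueness and asymptotics of resonances\<close>

lemma abs_Im_le_norm_cos: "\<bar>Im z\<bar> \<le> cmod (cos z)"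
proof -
  \<comment> \<open>The squared modulus of the cosine is cos^2 (Re z) + sinh^2 (Im z), and |sinh y|
    is at least |y|.\<close>
  have "(Im z)\<^sup>2 \<le> (cmod (cos z))\<^sup>2 - (cos (Re z))\<^sup>2"
    using norm_cos_squared[of z] real_le_abs_sinh[of "Im z"]
    by (simp only: abs_le_square_iff) (simp add: field_split_simps)
  also have "\<dots> \<le> (cmod (cos z))\<^sup>2" by simp
  finally show ?thesis using abs_le_square_iff by force
qed

text \<open>A crude bound that holds on the whole plane, so that it applies to a solution of the
  fixed point equation before anything is known about its size. The imaginary part is controlled
  through sin w = cos (pi / 2 - w).\<close>

lemma norm_Arcsin_bounded: "cmod (Arcsin z) \<le> pi + cmod z"
proof -
  have "\<bar>Im (Arcsin z)\<bar> \<le> cmod z"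
    using abs_Im_le_norm_cos[of "of_real (pi / 2) - Arcsin z"]
    by (simp add: cos_diff cos_of_real sin_of_real del: of_real_divide)
  then show ?thesis
    using cmod_le[of "Arcsin z"] Re_Arcsin_bound[of z] by linarith
qed

lemma cos_Arcsin_csqrt: "\<bar>Re z\<bar> < 1 \<Longrightarrow> cos (Arcsin z) = csqrt (1 - z\<^sup>2)"
  using cos_sin_csqrt[of "Arcsin z"] Arcsin_bounds[of z] by (simp add: cos_gt_zero_pi abs_less_iff)

text \<open>The derivative is the inverse of \<open>csqrt (1 - z\<^sup>2)\<close>, whose modulus is
  at least 1/2 on this disc.\<close>

lemma Arcsin_lipschitz:
  assumes "cmod z \<le> 1 / 2" "cmod w \<le> 1 / 2"
  shows "cmod (Arcsin z - Arcsin w) \<le> 2 * cmod (z - w)"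
proof (rule field_differentiable_bound[of "cball 0 (1 / 2)" Arcsin "\<lambda>z. inverse (cos (Arcsin z))"])
  fix u :: complex assume u: "u \<in> cball 0 (1 / 2)"
  then have Re: "\<bar>Re u\<bar> < 1" using abs_Re_le_cmod[of u] by simp
  then show "(Arcsin has_field_derivative inverse (cos (Arcsin u))) (at u within cball 0 (1 / 2))"
    by (simp add: has_field_derivative_at_within[OF has_field_derivative_Arcsin])
  have "(cmod u)\<^sup>2 \<le> (1 / 2)\<^sup>2" using u by (intro power_mono) auto
  then have "1 / 4 \<le> cmod (1 - u\<^sup>2)"
    using norm_triangle_ineq2[of 1 "u\<^sup>2"] by (simp add: norm_power power_divide)
  then have "1 / 2 \<le> cmod (cos (Arcsin u))"
    unfolding cos_Arcsin_csqrt[OF Re] norm_csqrt by (intro real_le_rsqrt) (simp add: power2_eq_square)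
  then show "cmod (inverse (cos (Arcsin u))) \<le> 2"
    using le_imp_inverse_le[of "1 / 2" "cmod (cos (Arcsin u))"] by (simp add: norm_inverse)
qed (use assms in auto)

lemma norm_Arcsin_le: "cmod z \<le> 1 / 2 \<Longrightarrow> cmod (Arcsin z) \<le> 2 * cmod z"
  using Arcsin_lipschitz[of z 0] by simp

text \<open>Im (sin w) = cos (Re w) * sinh (Im w), and the cosine is positive in the strip that
  contains the values of \<open>Arcsin\<close> here.\<close>

lemma Im_Arcsin_neg:
  assumes "Im z < 0" "\<bar>Re z\<bar> < 1"
  shows "Im (Arcsin z) < 0"
proof -
  define b where "b = Im (Arcsin z)"
  have "Im (sin (Arcsin z)) < 0" using assms by simp
  then have "cos (Re (Arcsin z)) * ((exp b - exp (- b)) / 2) < 0"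
    by (simp only: Im_sin b_def)
  moreover have "cos (Re (Arcsin z)) > 0"
    using Arcsin_bounds[OF assms(2)] by (intro cos_gt_zero_pi) auto
  ultimately have "exp b < exp (- b)" by (simp add: mult_less_0_iff)
  then show ?thesis by (simp add: b_def)
qed

text \<open>The resonance condition for \<open>\<kappa> = ktilde / b\<close>, with \<open>p = n * pi / 2\<close> and \<open>s = 1 / (a * b)\<close>, since
  \<open>- \<i> * Ln (\<kappa> + csqrt (\<kappa>\<^sup>2 + 1)) = Arcsin (- \<i> * \<kappa>)\<close>. For small \<open>s\<close> it is a contraction.\<close>

definition fixed_eq :: "real \<Rightarrow> real \<Rightarrow> complex \<Rightarrow> bool" where
  "fixed_eq p s \<kappa> \<longleftrightarrow> \<kappa> = of_real s * (of_real p + Arcsin (- \<i> * \<kappa>))"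

text \<open>A priori bound: every solution already lies in the disc on which the contraction is set
  up, which makes uniqueness global. The equation gives |\<kappa>| \<le> 1/4 + |\<kappa>| /
  4.\<close>

lemma fixed_eq_small:
  assumes "fixed_eq p s \<kappa>" "0 < s" "0 \<le> p" "s * (p + pi + 1) \<le> 1 / 4"
  shows "cmod \<kappa> \<le> 1 / 2"
proof -
  have "cmod \<kappa> = cmod (of_real s * (of_real p + Arcsin (- \<i> * \<kappa>)))"
    using assms(1) unfolding fixed_eq_def by (rule arg_cong)
  also have "\<dots> \<le> s * (p + cmod (Arcsin (- \<i> * \<kappa>)))"
    using assms(2,3) norm_triangle_ineq[of "of_real p" "Arcsin (- \<i> * \<kappa>)"]
    by (simp add: norm_mult)
  also have "\<dots> \<le> s * (p + (pi + cmod \<kappa>))"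
    using norm_Arcsin_bounded[of "- \<i> * \<kappa>"] assms(2) by (intro mult_left_mono) (auto simp: norm_mult)
  finally have *: "cmod \<kappa> \<le> s * (p + pi) + s * cmod \<kappa>" by (simp add: algebra_simps)
  have s: "s \<le> 1 / 4" "s * (p + pi) \<le> 1 / 4"
  proof -
    have "s * (p + pi + 1) = s * (p + pi) + s" by (simp add: distrib_left)
    moreover have "0 \<le> s * (p + pi)" using assms by simp
    ultimately show "s \<le> 1 / 4" "s * (p + pi) \<le> 1 / 4" using assms(2,4) by linarith+
  qed
  then have "s * cmod \<kappa> \<le> 1 / 4 * cmod \<kappa>" by (intro mult_right_mono) auto
  with * s show ?thesis by linarith
qed

text \<open>Banach's fixed point theorem on the closed disc of radius 1/2: \<open>Arcsin\<close> has
  Lipschitz constant 2 there and \<open>s\<close> is at most 1/4, so the contraction factor is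
  1/2.\<close>

lemma fixed_eq_exists1:
  assumes "0 < s" "0 \<le> p" "s * (p + pi + 1) \<le> 1 / 4"
  shows "\<exists>!\<kappa>. fixed_eq p s \<kappa>"
proof -
  define f where "f = (\<lambda>\<kappa>. of_real s * (of_real p + Arcsin (- \<i> * \<kappa>)))"
  have s: "s \<le> 1 / 4" "s * (p + 1) \<le> 1 / 4"
  proof -
    have "s * 1 \<le> s * (p + pi + 1)" "s * (p + 1) \<le> s * (p + pi + 1)"
      using assms by (auto intro!: mult_left_mono)
    then show "s \<le> 1 / 4" "s * (p + 1) \<le> 1 / 4" using assms(3) by auto
  qed
  have "\<exists>!\<kappa>\<in>cball 0 (1 / 2). f \<kappa> = \<kappa>"
  proof (rule Banach_fix)
    show "f ` cball 0 (1 / 2) \<subseteq> cball 0 (1 / 2)"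
    proof clarify
      fix k :: complex assume k: "k \<in> cball 0 (1 / 2)"
      have "cmod (of_real p + Arcsin (- \<i> * k)) \<le> p + 1"
        using norm_Arcsin_le[of "- \<i> * k"] k assms norm_triangle_ineq[of "of_real p" "Arcsin (- \<i> * k)"]
        by (simp add: norm_mult)
      then have "cmod (f k) \<le> s * (p + 1)"
        using assms by (simp add: f_def norm_mult)
      then show "f k \<in> cball 0 (1 / 2)" using s by simp
    qed
    show "dist (f x) (f y) \<le> 1 / 2 * dist x y"
      if "x \<in> cball 0 (1 / 2)" "y \<in> cball 0 (1 / 2)" for x y
    proof -
      have "f x - f y = of_real s * (Arcsin (- \<i> * x) - Arcsin (- \<i> * y))"
        unfolding f_def by (simp add: ring_distribs)
      then have "dist (f x) (f y) = s * cmod (Arcsin (- \<i> * x) - Arcsin (- \<i> * y))"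
        using assms(1) by (simp add: dist_norm norm_mult)
      also have "\<dots> \<le> 1 / 4 * (2 * cmod (- \<i> * x - - \<i> * y))"
        using that s assms(1) by (intro mult_mono Arcsin_lipschitz) (simp_all add: norm_mult)
      also have "- \<i> * x - - \<i> * y = - \<i> * (x - y)" by (simp add: ring_distribs)
      also have "1 / 4 * (2 * cmod (- \<i> * (x - y))) = 1 / 2 * dist x y"
        by (simp add: dist_norm norm_mult)
      finally show ?thesis .
    qed
  qed (simp_all add: complete_eq_closed)
  moreover have "fixed_eq p s \<kappa> \<longleftrightarrow> \<kappa> \<in> cball 0 (1 / 2) \<and> f \<kappa> = \<kappa>" for \<kappa>
  proof -
    have "fixed_eq p s \<kappa> \<longleftrightarrow> f \<kappa> = \<kappa>" unfolding fixed_eq_def f_def by (rule eq_commute)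
    then show ?thesis using fixed_eq_small[OF _ assms, of \<kappa>] unfolding mem_cball_0 by blast
  qed
  ultimately show ?thesis by simp
qed

section \<open>Correspondence between resonances and fixed points\<close>

text \<open>Recovers k from \<kappa> = \<open>ktilde\<close> / b: since k^2 = b^2 * (\<kappa>^2 +
  1), this is the root with nonnegative real part.\<close>

definition barrier_k :: "real \<Rightarrow> complex \<Rightarrow> complex" where
  "barrier_k b \<kappa> = of_real b * csqrt (\<kappa>\<^sup>2 + 1)"

text \<open>The condition \<open>Re z > 0\<close> makes z / b the principal root of \<kappa>^2 + 1,
  so a resonance is determined by its \<kappa>.\<close>

lemma is_resonance_imp:
  assumes "0 < a" "0 < lam" "is_resonance a lam n z"
  defines "b \<equiv> sqrt (2 * lam)"
  defines "\<kappa> \<equiv> ktilde lam z / of_real b"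
  shows "fixed_eq (real n * pi / 2) (1 / (a * b)) \<kappa>" "z = barrier_k b \<kappa>"
proof -
  have b: "b > 0" "b\<^sup>2 = 2 * lam" using assms(2) by (auto simp: b_def)
  have eq: "\<kappa> = of_real (real n * pi / (2 * a * b))
              - \<i> / of_real (a * b) * Ln (\<kappa> + csqrt (\<kappa>\<^sup>2 + 1))" and pos: "Re z > 0"
    using assms(3) unfolding is_resonance_def Let_def b_def[symmetric] \<kappa>_def[symmetric] by auto
  have "Arcsin (- \<i> * \<kappa>) = - \<i> * Ln (\<kappa> + csqrt (\<kappa>\<^sup>2 + 1))"
    by (simp add: Arcsin_def power_mult_distrib add.commute)
  then show "fixed_eq (real n * pi / 2) (1 / (a * b)) \<kappa>"
    unfolding fixed_eq_def using b assms(1) by (subst eq) (simp add: field_simps)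
  have "(of_real b * \<kappa>)\<^sup>2 = z\<^sup>2 - of_real (b\<^sup>2)"
    using b by (simp add: \<kappa>_def ktilde_def)
  then have "z\<^sup>2 = (of_real b)\<^sup>2 * (\<kappa>\<^sup>2 + 1)"
    by (simp add: power_mult_distrib algebra_simps)
  then have "(z / of_real b)\<^sup>2 = \<kappa>\<^sup>2 + 1" using b by (simp add: field_simps)
  then have "csqrt (\<kappa>\<^sup>2 + 1) = z / of_real b"
    using pos b by (intro csqrt_unique) auto
  then show "z = barrier_k b \<kappa>" using b by (simp add: barrier_k_def)
qed

text \<open>The converse requires the signs. For \<open>n \<ge> 1\<close> the term \<open>p\<close>
  dominates the arcsine, so \<kappa> lies in the right half-plane, then in the fourth quadrant, and
  so does the root of \<kappa>^2 + 1.\<close>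

lemma fixed_eq_imp_is_resonance:
  assumes "0 < a" "0 < lam" "n \<ge> 1"
  defines "b \<equiv> sqrt (2 * lam)"
  assumes small: "1 / (a * b) * (real n * pi / 2 + pi + 1) \<le> 1 / 4"
    and fixed: "fixed_eq (real n * pi / 2) (1 / (a * b)) \<kappa>"
  shows "is_resonance a lam n (barrier_k b \<kappa>)" "ktilde lam (barrier_k b \<kappa>) = of_real b * \<kappa>"
proof -
  define s where "s = 1 / (a * b)"
  define p where "p = real n * pi / 2"
  have b: "b > 0" "b\<^sup>2 = 2 * lam" using assms(2) by (auto simp: b_def)
  have small': "s * (p + pi + 1) \<le> 1 / 4" and fixed': "fixed_eq p s \<kappa>"
    using small fixed by (simp_all only: s_def p_def)
  have s: "0 < s" "s \<le> 1 / 4" and p: "p > 1"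
  proof -
    show "0 < s" using assms(1) b by (simp add: s_def)
    have "2 < pi" using pi_gt3 by simp
    moreover have "pi \<le> real n * pi" using assms(3) by simp
    ultimately show "p > 1" unfolding p_def by linarith
    then have "s * 1 \<le> s * (p + pi + 1)"
      using \<open>0 < s\<close> by (intro mult_left_mono) auto
    then show "s \<le> 1 / 4" using small' by linarith
  qed
  have k: "cmod \<kappa> \<le> 1 / 2"
    using fixed_eq_small[OF fixed' s(1) _ small'] p by linarith
  have eq: "\<kappa> = of_real s * (of_real p + Arcsin (- \<i> * \<kappa>))"
    using fixed' unfolding fixed_eq_def .
  have small_arc: "cmod (Arcsin (- \<i> * \<kappa>)) \<le> 1"
    using norm_Arcsin_le[of "- \<i> * \<kappa>"] k by (simp add: norm_mult)
  have Re_eq: "Re \<kappa> = s * (p + Re (Arcsin (- \<i> * \<kappa>)))" and Im_eq: "Im \<kappa> = s * Im (Arcsin (- \<i> * \<kappa>))"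
    using arg_cong[OF eq, of Re] arg_cong[OF eq, of Im] by simp_all
  have Re: "Re \<kappa> > 0"
    using Re_eq s p small_arc abs_Re_le_cmod[of "Arcsin (- \<i> * \<kappa>)"] by (simp add: zero_less_mult_iff)
  have ri: "\<bar>Im \<kappa>\<bar> < 1" using abs_Im_le_cmod[of \<kappa>] k by linarith
  \<comment> \<open>The argument of \<open>Arcsin\<close> has imaginary part
    \<open>- Re \<kappa>\<close>, which is negative.\<close>
  have Im: "Im \<kappa> < 0"
    using Im_eq s Im_Arcsin_neg[of "- \<i> * \<kappa>"] Re ri by (simp add: mult_less_0_iff)
  define q where "q = csqrt (\<kappa>\<^sup>2 + 1)"
  have q2: "q\<^sup>2 = \<kappa>\<^sup>2 + 1" by (simp add: q_def)
  have "Im (q\<^sup>2) < 0" using Re Im by (simp add: q2 Im_power2 mult_less_0_iff)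
  \<comment> \<open>\<open>Im (q\<^sup>2)\<close> is twice the product of the two parts of
    \<open>q\<close>, and a principal root has nonnegative real part.\<close>
  then have q: "Re q > 0" "Im q < 0"
    using Re_csqrt[of "\<kappa>\<^sup>2 + 1"] by (auto simp: Im_power2 mult_less_0_iff q_def[symmetric])
  have z: "barrier_k b \<kappa> = of_real b * q" by (simp add: barrier_k_def q_def)
  have "(of_real b * \<kappa>)\<^sup>2 = (of_real b * q)\<^sup>2 - 2 * of_real lam"
  proof -
    have "(of_real b * q)\<^sup>2 = (of_real b * \<kappa>)\<^sup>2 + of_real (b\<^sup>2)"
      by (simp add: power_mult_distrib q2 algebra_simps)
    then show ?thesis by (simp add: b)
  qed
  then show kt: "ktilde lam (barrier_k b \<kappa>) = of_real b * \<kappa>"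
    unfolding ktilde_def z using Re b by (intro csqrt_unique) auto
  have "Arcsin (- \<i> * \<kappa>) = - \<i> * Ln (\<kappa> + csqrt (\<kappa>\<^sup>2 + 1))"
    by (simp add: Arcsin_def power_mult_distrib add.commute)
  then have "of_real s * (of_real p + Arcsin (- \<i> * \<kappa>)) = of_real (real n * pi / (2 * a * b))
              - \<i> / of_real (a * b) * Ln (\<kappa> + csqrt (\<kappa>\<^sup>2 + 1))"
    using b assms(1) by (simp add: field_simps s_def p_def del: csqrt.simps)
  with eq have "\<kappa> = of_real (real n * pi / (2 * a * b))
              - \<i> / of_real (a * b) * Ln (\<kappa> + csqrt (\<kappa>\<^sup>2 + 1))"
    by (rule trans)
  then show "is_resonance a lam n (barrier_k b \<kappa>)"
    unfolding is_resonance_def Let_def b_def[symmetric] kt using b q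
    by (simp add: z mult_pos_neg)
qed

text \<open>Justifies the definite description: existence and uniqueness transfer from the fixed
  point equation through \<open>barrier_k\<close>.\<close>

lemma resonance_is_resonance:
  assumes "0 < a" "0 < lam" "n \<ge> 1"
    and small: "1 / (a * sqrt (2 * lam)) * (real n * pi / 2 + pi + 1) \<le> 1 / 4"
  shows "is_resonance a lam n (resonance a lam n)"
proof -
  have "0 < 1 / (a * sqrt (2 * lam))" "0 \<le> real n * pi / 2" using assms by auto
  then obtain \<kappa> where \<kappa>: "fixed_eq (real n * pi / 2) (1 / (a * sqrt (2 * lam))) \<kappa>"
    and uniq: "\<And>\<kappa>'. fixed_eq (real n * pi / 2) (1 / (a * sqrt (2 * lam))) \<kappa>' \<Longrightarrow> \<kappa>' = \<kappa>"
    using fixed_eq_exists1[OF _ _ small] by blast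
  have "is_resonance a lam n (barrier_k (sqrt (2 * lam)) \<kappa>)"
    using fixed_eq_imp_is_resonance(1)[OF assms(1-3) small \<kappa>] .
  moreover have "z = barrier_k (sqrt (2 * lam)) \<kappa>" if "is_resonance a lam n z" for z
    using is_resonance_imp[OF assms(1,2) that] uniq by simp
  ultimately have "is_resonance a lam n (THE z. is_resonance a lam n z)" by (rule theI)
  then show ?thesis using assms(3) by (simp add: resonance_def)
qed

text \<open>With \<alpha> = Arcsin (- \<i> * \<kappa>) the resonance condition reads
  \<open>ktilde\<close> * a = p + \<alpha>. For odd \<open>n\<close> the cosine of \<open>p\<close>
  vanishes, and by the addition formulas both terms of \<open>F\<close> have absolute value
  |\<kappa> * sin p| and cancel.\<close>

lemma is_resonance_F_eq_0:
  assumes "0 < a" "0 < lam" "odd n" "is_resonance a lam n z"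
    and small: "1 / (a * sqrt (2 * lam)) * (real n * pi / 2 + pi + 1) \<le> 1 / 4"
  shows "F a lam z = 0"
proof -
  define b where "b = sqrt (2 * lam)"
  define \<kappa> where "\<kappa> = ktilde lam z / of_real b"
  define p where "p = real n * pi / 2"
  define \<alpha> where "\<alpha> = Arcsin (- \<i> * \<kappa>)"
  have b: "b > 0" using assms(2) by (simp add: b_def)
  have fixed: "fixed_eq p (1 / (a * b)) \<kappa>" and z: "z = barrier_k b \<kappa>"
    using is_resonance_imp[OF assms(1,2,4)] by (simp_all only: b_def \<kappa>_def p_def)
  have "cmod \<kappa> \<le> 1 / 2"
    by (rule fixed_eq_small[OF fixed]) (use assms b in \<open>simp_all add: b_def p_def\<close>)
  then have "\<bar>Re (- \<i> * \<kappa>)\<bar> < 1" using abs_Im_le_cmod[of \<kappa>] by simp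
  then have cos\<alpha>: "cos \<alpha> = csqrt (\<kappa>\<^sup>2 + 1)"
    unfolding \<alpha>_def by (subst cos_Arcsin_csqrt) (auto simp: power_mult_distrib add.commute)
  have sin\<alpha>: "sin \<alpha> = - \<i> * \<kappa>" by (simp add: \<alpha>_def)
  have kt: "ktilde lam z = of_real b * \<kappa>" using b by (simp add: \<kappa>_def)
  have "\<kappa> = of_real (1 / (a * b)) * (of_real p + \<alpha>)" using fixed by (simp add: fixed_eq_def \<alpha>_def)
  then have "of_real (a * b) * \<kappa> = of_real (a * b) * (of_real (1 / (a * b)) * (of_real p + \<alpha>))"
    by (rule arg_cong)
  also have "\<dots> = of_real p + \<alpha>" using b assms(1) by simp
  finally have w: "ktilde lam z * of_real a = of_real p + \<alpha>"
    by (simp add: kt mult_ac)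
  obtain m where "n = 2 * m + 1" using assms(3) by (elim oddE)
  then have "p = real m * pi + pi / 2" by (simp add: p_def field_simps)
  then have "cos p = 0" by (simp add: cos_add)
  then have cosp: "cos (complex_of_real p) = 0" by (simp add: cos_of_real)
  have nz: "csqrt (\<kappa>\<^sup>2 + 1) \<noteq> 0"
  proof
    assume "csqrt (\<kappa>\<^sup>2 + 1) = 0"
    then have "z = 0" by (simp add: z barrier_k_def)
    then show False using assms(4) by (simp add: is_resonance_def)
  qed
  have "F a lam z = cos (of_real p + \<alpha>) - \<i> * (\<kappa> / csqrt (\<kappa>\<^sup>2 + 1)) * sin (of_real p + \<alpha>)"
  proof -
    have "ktilde lam z / z = of_real b * \<kappa> / barrier_k b \<kappa>" by (simp only: kt flip: z)
    also have "\<dots> = \<kappa> / csqrt (\<kappa>\<^sup>2 + 1)" using b by (simp add: barrier_k_def)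
    finally show ?thesis by (simp only: F_def w)
  qed
  also have "\<dots> = 0"
    using nz by (simp add: cos_add sin_add cosp cos\<alpha> sin\<alpha> del: csqrt.simps)
  finally show ?thesis .
qed

section \<open>Asymptotics of the resonances for large \<open>lam\<close>\<close>

lemma eventually_small:
  "\<forall>\<^sub>F lam in at_top. 0 < lam \<and> 1 / (a * sqrt (2 * lam)) * C \<le> 1 / 4"
proof -
  have "((\<lambda>lam. 1 / (a * sqrt (2 * lam)) * C) \<longlongrightarrow> 0) at_top"
  \<comment> \<open>For \<open>a = 0\<close> division by zero makes the expression constantly
    0.\<close>
  proof (cases "a = 0")
    case False
    then show ?thesis by real_asymp
  qed simp
  then have "\<forall>\<^sub>F lam in at_top. 1 / (a * sqrt (2 * lam)) * C < 1 / 4"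
    by (rule order_tendstoD) simp
  with eventually_gt_at_top[of 0] show ?thesis by eventually_elim simp
qed

text \<open>With b = \<open>sqrt (2 * lam)\<close> and q =
  \<open>csqrt (\<kappa>\<^sup>2 + 1)\<close>, the rescaled resonance is b^2 * (q - 1) = (b *
  \<kappa>)^2 / (q + 1). Here \<kappa> tends to 0 and b * \<kappa> to n * pi / (2 * a). The case
  \<open>n = 0\<close> is included because the window for \<open>n = 1\<close> refers to it.\<close>

lemma resonance_scaled_tendsto:
  assumes a: "0 < a"
  shows "((\<lambda>lam. of_real (sqrt (2 * lam)) * (resonance a lam n - of_real (sqrt (2 * lam))))
    \<longlongrightarrow> of_real ((real n * pi)\<^sup>2 / (8 * a\<^sup>2))) at_top"
proof (cases "n = 0")
  case True
  then show ?thesis by (simp add: resonance_def)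
next
  case False
  then have n: "n \<ge> 1" by simp
  define p where "p = real n * pi / 2"
  have p: "0 \<le> p" by (simp add: p_def)
  define \<kappa> where "\<kappa> = (\<lambda>lam. ktilde lam (resonance a lam n) / of_real (sqrt (2 * lam)))"
  have small: "\<forall>\<^sub>F lam in at_top. 0 < lam \<and> 1 / (a * sqrt (2 * lam)) * (p + pi + 1) \<le> 1 / 4"
    by (rule eventually_small)
  then have ev: "\<forall>\<^sub>F lam in at_top. 0 < lam \<and> fixed_eq p (1 / (a * sqrt (2 * lam))) (\<kappa> lam) \<and>
      cmod (\<kappa> lam) \<le> 1 / 2 \<and> resonance a lam n = barrier_k (sqrt (2 * lam)) (\<kappa> lam)"
  proof eventually_elim
    case (elim lam)
    then have "is_resonance a lam n (resonance a lam n)"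
      using resonance_is_resonance[OF a _ n] by (simp add: p_def)
    note * = is_resonance_imp[OF a _ this, folded p_def]
    have "fixed_eq p (1 / (a * sqrt (2 * lam))) (\<kappa> lam)" using *(1) elim by (simp add: \<kappa>_def)
    moreover from this have "cmod (\<kappa> lam) \<le> 1 / 2"
      by (rule fixed_eq_small) (use a elim in \<open>auto simp: p_def\<close>)
    ultimately show ?case using *(2) elim by (simp add: \<kappa>_def)
  qed
  have \<kappa>_0: "(\<kappa> \<longlongrightarrow> 0) at_top"
  proof (rule Lim_null_comparison)
    show "\<forall>\<^sub>F lam in at_top. cmod (\<kappa> lam) \<le> 1 / (a * sqrt (2 * lam)) * (p + 1)"
      using ev
    proof eventually_elim
      case (elim lam)
      have "cmod (Arcsin (- \<i> * \<kappa> lam)) \<le> 1"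
        using norm_Arcsin_le[of "- \<i> * \<kappa> lam"] elim by (simp add: norm_mult)
      then have "cmod (of_real p + Arcsin (- \<i> * \<kappa> lam)) \<le> p + 1"
        using norm_triangle_ineq[of "of_real p" "Arcsin (- \<i> * \<kappa> lam)"] p by simp
      moreover have "cmod (\<kappa> lam) = cmod (of_real (1 / (a * sqrt (2 * lam))) * (of_real p + Arcsin (- \<i> * \<kappa> lam)))"
        using elim unfolding fixed_eq_def by (intro arg_cong[of _ _ cmod]) simp
      ultimately show ?case
        using a elim unfolding norm_mult norm_of_real by (simp add: divide_right_mono)
    qed
    show "((\<lambda>lam. 1 / (a * sqrt (2 * lam)) * (p + 1)) \<longlongrightarrow> 0) at_top"
      using a by real_asymp
  qed
  \<comment> \<open>The rescaled resonance as a function of \<kappa> alone, continuous at 0; the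
    fixed point equation has replaced b * \<kappa>.\<close>
  define U where "U = (\<lambda>\<kappa>. ((of_real p + Arcsin (- \<i> * \<kappa>)) / of_real a)\<^sup>2 / (csqrt (\<kappa>\<^sup>2 + 1) + 1))"
  have "isCont U 0"
    unfolding U_def using a by (intro continuous_intros isCont_Arcsin' isCont_csqrt') auto
  then have "((\<lambda>lam. U (\<kappa> lam)) \<longlongrightarrow> U 0) at_top"
    by (rule isCont_tendsto_compose[OF _ \<kappa>_0])
  also have "U 0 = of_real ((real n * pi)\<^sup>2 / (8 * a\<^sup>2))"
    by (simp add: U_def p_def power_divide)
  finally have lim: "((\<lambda>lam. U (\<kappa> lam)) \<longlongrightarrow> of_real ((real n * pi)\<^sup>2 / (8 * a\<^sup>2))) at_top" .
  have "\<forall>\<^sub>F lam in at_top. U (\<kappa> lam) = of_real (sqrt (2 * lam)) * (resonance a lam n - of_real (sqrt (2 * lam)))"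
    using ev
  proof eventually_elim
    case (elim lam)
    define b where "b = sqrt (2 * lam)"
    define q where "q = csqrt ((\<kappa> lam)\<^sup>2 + 1)"
    have b: "b > 0" using elim by (simp add: b_def)
    have res: "resonance a lam n = of_real b * q"
      using elim by (simp add: barrier_k_def b_def q_def)
    have q1: "q + 1 \<noteq> 0"
    proof
      assume "q + 1 = 0"
      then have "q = - 1" by (simp add: eq_neg_iff_add_eq_0)
      then show False using Re_csqrt[of "(\<kappa> lam)\<^sup>2 + 1"] by (simp add: q_def[symmetric])
    qed
    have "\<kappa> lam = of_real (1 / (a * b)) * (of_real p + Arcsin (- \<i> * \<kappa> lam))"
      using elim unfolding fixed_eq_def b_def by blast
    then have "of_real b * \<kappa> lam = of_real b * (of_real (1 / (a * b)) * (of_real p + Arcsin (- \<i> * \<kappa> lam)))"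
      by (rule arg_cong)
    also have "\<dots> = (of_real p + Arcsin (- \<i> * \<kappa> lam)) / of_real a"
      using b by simp
    finally have "U (\<kappa> lam) = (of_real b * \<kappa> lam)\<^sup>2 / (q + 1)"
      by (simp only: U_def q_def)
    also have "(\<kappa> lam)\<^sup>2 = (q - 1) * (q + 1)"
      by (simp add: q_def algebra_simps flip: power2_eq_square)
    then have "(of_real b * \<kappa> lam)\<^sup>2 = (of_real b)\<^sup>2 * (q - 1) * (q + 1)"
      by (simp only: power_mult_distrib mult.assoc)
    then have "(of_real b * \<kappa> lam)\<^sup>2 / (q + 1) = of_real b * (of_real b * q - of_real b)"
      using q1 by (simp add: power2_eq_square right_diff_distrib)
    finally show ?case by (simp only: res b_def[symmetric])
  qed
  then show ?thesis by (rule Lim_transform_eventually[OF lim])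
qed

section \<open>The rescaled denominator\<close>

text \<open>\<open>F\<close> at \<open>k = 1 / e + e * u\<close> with \<open>2 * lam = 1 / e\<^sup>2\<close>, extended to \<open>e = 0\<close>.\<close>

definition scaled_F :: "real \<Rightarrow> real \<Rightarrow> complex \<Rightarrow> complex" where
  "scaled_F a e u = (let q = csqrt (2 * u + of_real (e\<^sup>2) * u\<^sup>2) in
     cos (q * of_real a) - \<i> * of_real e * (q * sin (q * of_real a)) / (1 + of_real (e\<^sup>2) * u))"

text \<open>Put k = b + u / b in k^2 - b^2 = (k - b) * (k + b).\<close>

lemma ktilde_scaled:
  fixes k :: complex
  assumes "lam > 0"
  defines "b \<equiv> sqrt (2 * lam)"
  defines "u \<equiv> of_real b * (k - of_real b)"
  shows "ktilde lam k = csqrt (2 * u + of_real ((1 / b)\<^sup>2) * u\<^sup>2)"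
proof -
  have b: "b > 0" "b\<^sup>2 = 2 * lam" using assms(1) by (auto simp: b_def)
  have "of_real ((1 / b)\<^sup>2) * u\<^sup>2 = (k - of_real b)\<^sup>2"
    using b(1) by (simp add: u_def power_mult_distrib power_divide)
  then have "2 * u + of_real ((1 / b)\<^sup>2) * u\<^sup>2 = k\<^sup>2 - of_real (b\<^sup>2)"
    by (simp add: u_def power2_eq_square algebra_simps)
  then show ?thesis by (simp add: ktilde_def b(2))
qed

lemma F_scaled:
  assumes "lam > 0"
  defines "b \<equiv> sqrt (2 * lam)"
  shows "F a lam k = scaled_F a (1 / b) (of_real b * (k - of_real b))"
proof -
  have b: "b > 0" using assms(1) by (simp add: b_def)
  define u where "u = of_real b * (k - of_real b)"
  have "1 + of_real ((1 / b)\<^sup>2) * u = k / of_real b"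
    using b by (simp add: u_def field_simps power2_eq_square)
  then show ?thesis
    using ktilde_scaled[OF assms(1), of k] b
    by (simp add: F_def scaled_F_def Let_def u_def[symmetric] b_def[symmetric])
qed

section \<open>Holomorphy and uniform convergence of the rescaled denominator\<close>

lemma holomorphic_cos_csqrt: "(\<lambda>z. cos (csqrt z * x)) holomorphic_on UNIV"
  by (rule holomorphic_even_comp_csqrt[of "\<lambda>w. cos (w * x)"]) (auto intro!: holomorphic_intros)

lemma holomorphic_csqrt_sin_csqrt: "(\<lambda>z. csqrt z * sin (csqrt z * x)) holomorphic_on UNIV"
  by (rule holomorphic_even_comp_csqrt[of "\<lambda>w. w * sin (w * x)"]) (auto intro!: holomorphic_intros)

lemma holomorphic_scaled_F:
  assumes "\<And>u. u \<in> S \<Longrightarrow> 1 + of_real (e\<^sup>2) * u \<noteq> 0"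
  shows "scaled_F a e holomorphic_on S"
proof -
  define C where "C = (\<lambda>u. cos (csqrt (2 * u + of_real (e\<^sup>2) * u\<^sup>2) * of_real a))"
  \<comment> \<open>The root stays attached to its sine because only their product is even in the
    root, hence free of the branch cut.\<close>
  define D where "D = (\<lambda>u. csqrt (2 * u + of_real (e\<^sup>2) * u\<^sup>2) *
      sin (csqrt (2 * u + of_real (e\<^sup>2) * u\<^sup>2) * of_real a))"
  have poly: "(\<lambda>u. 2 * u + of_real (e\<^sup>2) * u\<^sup>2) holomorphic_on S"
    by (intro holomorphic_intros)
  have [holomorphic_intros]: "C holomorphic_on S" "D holomorphic_on S"
    unfolding C_def D_def
    using holomorphic_on_compose_gen[OF poly holomorphic_cos_csqrt]
      holomorphic_on_compose_gen[OF poly holomorphic_csqrt_sin_csqrt]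
    by (auto simp: o_def)
  have "(\<lambda>u. C u - \<i> * of_real e * D u / (1 + of_real (e\<^sup>2) * u)) holomorphic_on S"
    using assms by (intro holomorphic_intros) auto
  then show ?thesis
    by (simp add: C_def D_def scaled_F_def[abs_def] Let_def)
qed

lemma one_plus_scaled_nonzero:
  fixes u :: complex
  assumes "x\<^sup>2 * T < 1" "cmod u \<le> T"
  shows "1 + of_real (x\<^sup>2) * u \<noteq> 0"
proof
  assume "1 + of_real (x\<^sup>2) * u = 0"
  then have "of_real (x\<^sup>2) * u = - 1" by (simp add: add_eq_0_iff)
  then have "cmod (of_real (x\<^sup>2) * u) = 1" by simp
  then have "x\<^sup>2 * cmod u = 1" by (simp add: norm_mult norm_power)
  moreover have "x\<^sup>2 * cmod u \<le> x\<^sup>2 * T" using assms(2) by (intro mult_left_mono) auto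
  ultimately show False using assms(1) by simp
qed

text \<open>\<open>scaled_F\<close> is jointly continuous in both variables, including at parameter
  0, and compactness of the disc turns this into uniform convergence.\<close>

lemma uniform_limit_scaled_F:
  assumes e: "(e \<longlongrightarrow> 0) I"
  shows "uniform_limit (cball c R) (\<lambda>i. scaled_F a (e i)) (scaled_F a 0) I"
proof (rule uniform_limitI)
  fix d :: real assume d: "d > 0"
  \<comment> \<open>The parameters for which the denominator has no zero on the disc.\<close>
  define U where "U = {x :: real. x\<^sup>2 * (cmod c + R) < 1}"
  have nz: "1 + of_real (x\<^sup>2) * u \<noteq> 0" if "x \<in> U" "u \<in> cball c R" for x and u :: complex
  proof (rule one_plus_scaled_nonzero)
    show "x\<^sup>2 * (cmod c + R) < 1" using that(1) by (simp add: U_def)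
    show "cmod u \<le> cmod c + R"
      using that(2) norm_triangle_sub[of u c] by (simp add: dist_norm norm_minus_commute)
  qed
  define C where "C = (\<lambda>z. cos (csqrt (2 * snd z + of_real ((fst z)\<^sup>2) * (snd z)\<^sup>2) * of_real a))"
  define D where "D = (\<lambda>z. csqrt (2 * snd z + of_real ((fst z)\<^sup>2) * (snd z)\<^sup>2) *
      sin (csqrt (2 * snd z + of_real ((fst z)\<^sup>2) * (snd z)\<^sup>2) * of_real a))"
  have poly: "continuous_on A (\<lambda>z. 2 * snd z + of_real ((fst z)\<^sup>2) * (snd z)\<^sup>2)"
    for A :: "(real \<times> complex) set"
    by (intro continuous_intros)
  have [continuous_intros]: "continuous_on A C" "continuous_on A D" for A
    unfolding C_def D_def
    using continuous_on_compose2[OF holomorphic_on_imp_continuous_on[OF holomorphic_cos_csqrt] poly]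
      continuous_on_compose2[OF holomorphic_on_imp_continuous_on[OF holomorphic_csqrt_sin_csqrt] poly]
    by auto
  have "continuous_on (U \<times> cball c R)
      (\<lambda>z. C z - \<i> * of_real (fst z) * D z / (1 + of_real ((fst z)\<^sup>2) * snd z))"
    using nz by (intro continuous_intros) auto
  then have "continuous_on (U \<times> cball c R) (\<lambda>z. scaled_F a (fst z) (snd z))"
    by (simp add: C_def D_def scaled_F_def[abs_def] Let_def)
  moreover have "0 \<in> U" by (simp add: U_def)
  ultimately obtain X where X: "0 \<in> X" "open X"
    "\<forall>x\<in>X \<inter> U. \<forall>u\<in>cball c R. dist (scaled_F a x u) (scaled_F a 0 u) \<le> d / 2"
    using continuous_on_prod_compactE[of U "cball c R" "\<lambda>z. scaled_F a (fst z) (snd z)" 0 "d / 2"] d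
    by auto
  have "open U"
    unfolding U_def by (intro open_Collect_less continuous_intros)
  then have "\<forall>\<^sub>F i in I. e i \<in> X \<inter> U"
    using X \<open>0 \<in> U\<close> by (intro topological_tendstoD[OF e] open_Int) auto
  then show "\<forall>\<^sub>F i in I. \<forall>u\<in>cball c R. dist (scaled_F a (e i) u) (scaled_F a 0 u) < d"
  proof eventually_elim
    case (elim i)
    then show ?case using X(3) d by (auto intro: le_less_trans[of _ "d / 2"])
  qed
qed

section \<open>Zeros of the limit function\<close>

lemma scaled_F_0: "scaled_F a 0 u = cos (csqrt (2 * u) * of_real a)"
  by (simp add: scaled_F_def Let_def del: csqrt.simps)

lemma csqrt_two_center:
  assumes "0 < a" "n \<ge> 1"
  shows "csqrt (2 * of_real ((real n * pi)\<^sup>2 / (8 * a\<^sup>2))) = of_real (real n * pi / (2 * a))"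
proof (rule csqrt_unique)
  have "(real n * pi / (2 * a))\<^sup>2 = 2 * ((real n * pi)\<^sup>2 / (8 * a\<^sup>2))"
    by (simp add: power_divide power_mult_distrib)
  then show "(complex_of_real (real n * pi / (2 * a)))\<^sup>2 = 2 * of_real ((real n * pi)\<^sup>2 / (8 * a\<^sup>2))"
    by (metis of_real_mult of_real_numeral of_real_power)
  show "0 < Re (complex_of_real (real n * pi / (2 * a))) \<or>
      Re (complex_of_real (real n * pi / (2 * a))) = 0 \<and> 0 \<le> Im (complex_of_real (real n * pi / (2 * a)))"
    using assms by simp
qed

lemma
  assumes a: "0 < a" and n: "odd n"
  defines "c \<equiv> complex_of_real ((real n * pi)\<^sup>2 / (8 * a\<^sup>2))"
  shows scaled_F_0_center: "scaled_F a 0 c = 0"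
    and deriv_scaled_F_0_center: "deriv (scaled_F a 0) c \<noteq> 0"
proof -
  obtain m where m: "n = 2 * m + 1" using n by (elim oddE)
  then have n1: "n \<ge> 1" by simp
  define p where "p = real n * pi / 2"
  have "p = real m * pi + pi / 2" by (simp add: p_def m field_simps)
  then have p: "cos p = 0" "sin p \<noteq> 0" by (simp_all add: cos_add sin_add cos_npi sin_npi)
  have r: "csqrt (2 * c) = of_real (real n * pi / (2 * a))"
    unfolding c_def by (rule csqrt_two_center[OF a n1])
  then have ra: "csqrt (2 * c) * of_real a = of_real p"
    using a by (simp add: p_def)
  then show "scaled_F a 0 c = 0" using p by (simp add: scaled_F_0 cos_of_real)
  have "(real n * pi)\<^sup>2 / (8 * a\<^sup>2) > 0" using a n1 by simp
  \<comment> \<open>Away from the branch cut the root is differentiable, so the chain rule applies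
    directly.\<close>
  then have "2 * c \<notin> \<real>\<^sub>\<le>\<^sub>0"
    unfolding c_def complex_nonpos_Reals_iff by simp
  then have "((\<lambda>u. cos (csqrt (2 * u) * of_real a)) has_field_derivative
      - sin (csqrt (2 * c) * of_real a) * (2 * inverse (2 * csqrt (2 * c)) * of_real a)) (at c)"
    by (auto intro!: derivative_eq_intros simp: field_simps)
  then have "deriv (scaled_F a 0) c = - sin (csqrt (2 * c) * of_real a) * (2 * inverse (2 * csqrt (2 * c)) * of_real a)"
    unfolding scaled_F_0[abs_def] by (rule DERIV_imp_deriv)
  also have "\<dots> \<noteq> 0"
    unfolding ra unfolding r using p a n1 by (simp add: sin_of_real)
  finally show "deriv (scaled_F a 0) c \<noteq> 0" .
qed

text \<open>The zeros are the squares of odd positive integers in units of pi^2 / (8 * a^2), and the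
  radius is 2 * n such units. Another odd integer j differs from n by at least 2, so |n^2 - j^2|
  \<ge> 2 * (n + j) > 2 * n.\<close>

lemma scaled_F_0_unique_zero:
  assumes a: "0 < a" and n: "odd n"
  defines "c \<equiv> complex_of_real ((real n * pi)\<^sup>2 / (8 * a\<^sup>2))"
  assumes u: "u \<in> cball c (real n * pi\<^sup>2 / (4 * a\<^sup>2))" and zero: "scaled_F a 0 u = 0"
  shows "u = c"
proof -
  obtain j :: int where "csqrt (2 * u) * of_real a = of_real (j * pi) + of_real pi / 2"
    using zero by (auto simp: scaled_F_0 cos_eq_0 simp del: csqrt.simps)
  also have "\<dots> = of_real ((2 * j + 1) * pi / 2)" by (simp add: field_simps)
  finally have j: "csqrt (2 * u) * of_real a = of_real ((2 * j + 1) * pi / 2)" .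
  \<comment> \<open>The sign of the principal root leaves only nonnegative \<open>j\<close>.\<close>
  have "0 \<le> Re (csqrt (2 * u) * of_real a)"
    using Re_csqrt[of "2 * u"] a by (simp del: csqrt.simps)
  then have "0 \<le> (2 * j + 1) * pi / 2" unfolding j by simp
  then have "0 \<le> real_of_int (2 * j + 1) * pi" by simp
  then have "0 \<le> real_of_int (2 * j + 1)" by (meson mult_neg_pos not_le pi_gt_zero)
  then have j0: "0 \<le> j" by linarith
  have "(csqrt (2 * u) * of_real a)\<^sup>2 = of_real (((2 * j + 1) * pi / 2)\<^sup>2)"
    unfolding j by simp
  then have "2 * u * of_real (a\<^sup>2) = of_real (((2 * j + 1) * pi / 2)\<^sup>2)"
    by (simp add: power_mult_distrib del: csqrt.simps)
  then have ueq: "u = of_real (((2 * j + 1) * pi)\<^sup>2 / (8 * a\<^sup>2))"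
    using a by (simp add: field_simps)
  have "c - u = of_real ((real n * pi)\<^sup>2 / (8 * a\<^sup>2) - ((2 * j + 1) * pi)\<^sup>2 / (8 * a\<^sup>2))"
    by (simp only: ueq c_def of_real_diff)
  also have "(real n * pi)\<^sup>2 / (8 * a\<^sup>2) - ((2 * j + 1) * pi)\<^sup>2 / (8 * a\<^sup>2) =
      of_int ((int n)\<^sup>2 - (2 * j + 1)\<^sup>2) * (pi\<^sup>2 / (8 * a\<^sup>2))"
    by (simp add: power_mult_distrib diff_divide_distrib left_diff_distrib)
  finally have "cmod (c - u) = \<bar>real_of_int ((int n)\<^sup>2 - (2 * j + 1)\<^sup>2)\<bar> * (pi\<^sup>2 / (8 * a\<^sup>2))"
    by (simp only: norm_of_real abs_mult) simp
  moreover have "cmod (c - u) \<le> real n * pi\<^sup>2 / (4 * a\<^sup>2)" using u by (simp add: dist_norm)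
  moreover have "real n * pi\<^sup>2 / (4 * a\<^sup>2) = real_of_int (2 * int n) * (pi\<^sup>2 / (8 * a\<^sup>2))" by simp
  moreover have "pi\<^sup>2 / (8 * a\<^sup>2) > 0" using a by simp
  ultimately have "\<bar>real_of_int ((int n)\<^sup>2 - (2 * j + 1)\<^sup>2)\<bar> \<le> real_of_int (2 * int n)"
    by (metis mult_le_cancel_right_pos)
  then have le: "\<bar>(int n)\<^sup>2 - (2 * j + 1)\<^sup>2\<bar> \<le> 2 * int n"
    by linarith
  have "int n = 2 * j + 1"
  proof (rule ccontr)
    assume ne: "int n \<noteq> 2 * j + 1"
    obtain m where "int n = 2 * m + 1" using n by (metis even_of_nat oddE)
    with ne have "2 \<le> \<bar>int n - (2 * j + 1)\<bar>" by presburger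
    then have "2 * (int n + (2 * j + 1)) \<le> \<bar>int n - (2 * j + 1)\<bar> * (int n + (2 * j + 1))"
      using j0 by (intro mult_right_mono) auto
    also have "\<dots> = \<bar>(int n)\<^sup>2 - (2 * j + 1)\<^sup>2\<bar>"
    proof -
      have "(int n)\<^sup>2 - (2 * j + 1)\<^sup>2 = (int n - (2 * j + 1)) * (int n + (2 * j + 1))"
        by (simp add: power2_eq_square algebra_simps)
      then show ?thesis using j0 by (simp add: abs_mult)
    qed
    finally show False using order_trans[OF _ le] j0 by fastforce
  qed
  then have "real n = 2 * real_of_int j + 1" by (metis of_int_1 of_int_add of_int_mult of_int_numeral of_int_of_nat_eq)
  then show ?thesis by (simp add: ueq c_def)
qed

section \<open>The Laurent expansion at a resonance\<close>

text \<open>A window point is at distance at most the half gap plus the modulus of the imaginary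
  part of the resonance. After rescaling, the imaginary part tends to 0 and the half gap to (n -
  1/2) * pi^2 / (8 * a^2), strictly below the bound.\<close>

lemma window_eventually_close:
  assumes a: "0 < a" and n: "n \<ge> 1"
  shows "\<forall>\<^sub>F lam in at_top. \<forall>k\<in>window a lam n.
    sqrt (2 * lam) * cmod (of_real k - resonance a lam n) \<le> real n * pi\<^sup>2 / (8 * a\<^sup>2)"
proof -
  define U where "U = (\<lambda>m lam. of_real (sqrt (2 * lam)) * (resonance a lam m - of_real (sqrt (2 * lam))))"
  define h where "h = (\<lambda>lam. (Re (U n lam) - Re (U (n - 1) lam)) / 2 + \<bar>Im (U n lam)\<bar>)"
  define l where "l = (\<lambda>m. (real m * pi)\<^sup>2 / (8 * a\<^sup>2))"
  have lim: "(U m \<longlongrightarrow> of_real (l m)) at_top" for m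
    unfolding U_def l_def by (rule resonance_scaled_tendsto[OF a])
  have "(h \<longlongrightarrow> (Re (of_real (l n)) - Re (of_real (l (n - 1)))) / 2 + \<bar>Im (of_real (l n))\<bar>) at_top"
    unfolding h_def by (intro tendsto_intros lim) simp
  then have h_lim: "(h \<longlongrightarrow> (l n - l (n - 1)) / 2) at_top" by simp
  have "(l n - l (n - 1)) / 2 = (real n - 1 / 2) * (pi\<^sup>2 / (8 * a\<^sup>2))"
    using n a by (simp add: l_def of_nat_diff field_simps power2_eq_square)
  also have "\<dots> < real n * (pi\<^sup>2 / (8 * a\<^sup>2))"
    using a by (intro mult_strict_right_mono) auto
  finally have "\<forall>\<^sub>F lam in at_top. h lam < real n * pi\<^sup>2 / (8 * a\<^sup>2)"
    by (intro order_tendstoD(2)[OF h_lim]) simp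
  with eventually_gt_at_top[of 0] show ?thesis
  proof eventually_elim
    case (elim lam)
    define b where "b = sqrt (2 * lam)"
    have b: "b > 0" using elim by (simp add: b_def)
    show ?case
    proof
      fix k assume k: "k \<in> window a lam n"
      have "cmod (of_real k - resonance a lam n) \<le>
          \<bar>k - Re (resonance a lam n)\<bar> + \<bar>Im (resonance a lam n)\<bar>"
        using cmod_le[of "of_real k - resonance a lam n"] by simp
      also have "\<bar>k - Re (resonance a lam n)\<bar> \<le> half_gap a lam n"
        using k by (auto simp: window_def abs_le_iff)
      finally have "b * cmod (of_real k - resonance a lam n) \<le>
          b * (half_gap a lam n + \<bar>Im (resonance a lam n)\<bar>)"
        using b by simp
      also have "\<dots> = h lam"
        using b unfolding h_def U_def b_def[symmetric] half_gap_def
        by (simp add: abs_mult algebra_simps diff_divide_distrib)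
      finally show "sqrt (2 * lam) * cmod (of_real k - resonance a lam n) \<le> real n * pi\<^sup>2 / (8 * a\<^sup>2)"
        using elim by (simp add: b_def)
    qed
  qed
qed

text \<open>Bounds the numerator of the eigenfunction uniformly in \<open>x\<close> and
  \<open>e\<close>, by |cos w| \<le> exp |w|.\<close>

lemma norm_cos_csqrt_le:
  assumes "0 \<le> e" "e \<le> 1" "cmod u \<le> T" "\<bar>x\<bar> \<le> a"
  shows "cmod (cos (csqrt (2 * u + of_real (e\<^sup>2) * u\<^sup>2) * of_real x)) \<le> exp (sqrt (2 * T + T\<^sup>2) * a)"
proof -
  have T: "0 \<le> T" using assms(3) norm_ge_zero order_trans by blast
  have "cmod (2 * u + of_real (e\<^sup>2) * u\<^sup>2) \<le> 2 * cmod u + e\<^sup>2 * (cmod u)\<^sup>2"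
    using norm_triangle_ineq[of "2 * u" "of_real (e\<^sup>2) * u\<^sup>2"] by (simp add: norm_mult norm_power)
  also have "\<dots> \<le> 2 * T + 1 * T\<^sup>2"
    using assms by (intro add_mono mult_mono power_mono) (auto simp: power_le_one)
  finally have "sqrt (cmod (2 * u + of_real (e\<^sup>2) * u\<^sup>2)) * \<bar>x\<bar> \<le> sqrt (2 * T + T\<^sup>2) * a"
    using assms T by (intro mult_mono) auto
  then show ?thesis
    by (intro order_trans[OF norm_cos_le]) (simp add: norm_mult)
qed

lemma phase_phi_eq: "phase_phi a lam x k = cos (ktilde lam k * of_real x) / (of_real (sqrt pi) * F a lam k)"
  by (simp add: phase_phi_def phi_def mult_exp_exp exp_minus field_simps)

text \<open>The factorization F = b * (k - z) * Q, with \<open>Q\<close> bounded below, leaves a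
  numerator \<open>P\<close> of order 1 / b on a disc of radius of order 1 / b.\<close>

lemma phase_phi_near_resonance:
  assumes a: "0 < a" and n: "odd n"
  defines "R \<equiv> real n * pi\<^sup>2 / (4 * a\<^sup>2)"
  obtains B where "B > 0" "\<forall>\<^sub>F lam in at_top. \<forall>x\<in>{-a..a}. \<exists>P S. open S \<and>
    cball (resonance a lam n) (3 / 4 * R / sqrt (2 * lam)) \<subseteq> S \<and> P holomorphic_on S \<and>
    (\<forall>k\<in>S. cmod (P k) \<le> B / sqrt (2 * lam)) \<and>
    (\<forall>k\<in>S. phase_phi a lam x k = P k / (k - resonance a lam n))"
proof -
  define c where "c = complex_of_real ((real n * pi)\<^sup>2 / (8 * a\<^sup>2))"
  define e where "e = (\<lambda>lam. 1 / sqrt (2 * lam))"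
  define \<zeta> where "\<zeta> = (\<lambda>lam. of_real (sqrt (2 * lam)) * (resonance a lam n - of_real (sqrt (2 * lam))))"
  have n1: "n \<ge> 1" using n by (cases n) auto
  have R: "R > 0" using a n1 by (simp add: R_def)
  \<comment> \<open>Bounds |u| on the disc of radius \<open>2 * R\<close>, the open set on which the
    factorization takes place.\<close>
  define T where "T = cmod c + 2 * R"
  have e_lim: "(e \<longlongrightarrow> 0) at_top" unfolding e_def by real_asymp
  have e_lt: "\<forall>\<^sub>F lam in at_top. 0 < lam \<and> 0 < e lam \<and> e lam < 1 \<and> (e lam)\<^sup>2 * T < 1"
  proof -
    have "((\<lambda>lam. (e lam)\<^sup>2 * T) \<longlongrightarrow> 0\<^sup>2 * T) at_top" by (intro tendsto_intros e_lim)
    then have "\<forall>\<^sub>F lam in at_top. (e lam)\<^sup>2 * T < 1" by (intro order_tendstoD(2)) auto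
    moreover have "\<forall>\<^sub>F lam in at_top. e lam < 1" by (rule order_tendstoD(2)[OF e_lim]) simp
    ultimately show ?thesis using eventually_gt_at_top[of 0]
      by eventually_elim (simp add: e_def)
  qed
  have nz: "1 + of_real (x\<^sup>2) * u \<noteq> 0" if "x\<^sup>2 * T < 1" "u \<in> ball c (2 * R)" for x u
    using that(2) norm_triangle_sub[of u c]
    by (intro one_plus_scaled_nonzero[OF that(1)]) (simp add: T_def dist_norm norm_minus_commute)
  have zero: "\<forall>\<^sub>F lam in at_top. scaled_F a (e lam) (\<zeta> lam) = 0"
    using eventually_small[of a "real n * pi / 2 + pi + 1"]
  proof eventually_elim
    case (elim lam)
    then have "F a lam (resonance a lam n) = 0"
      using resonance_is_resonance[OF a _ n1] is_resonance_F_eq_0[OF a _ n] by blast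
    then show ?case using F_scaled[of lam a "resonance a lam n"] elim by (simp add: \<zeta>_def e_def)
  qed
  have \<zeta>_lim: "(\<zeta> \<longlongrightarrow> c) at_top"
    unfolding \<zeta>_def c_def by (rule resonance_scaled_tendsto[OF a])
  have holo_e: "\<forall>\<^sub>F lam in at_top. scaled_F a (e lam) holomorphic_on ball c (2 * R)"
    using e_lt by eventually_elim (intro holomorphic_scaled_F nz, auto)
  have holo_0: "scaled_F a 0 holomorphic_on ball c (2 * R)"
    by (intro holomorphic_scaled_F) simp
  have sub: "cball c R \<subseteq> ball c (2 * R)" using R by auto
  have unique: "\<forall>u\<in>cball c R. scaled_F a 0 u = 0 \<longrightarrow> u = c"
    using scaled_F_0_unique_zero[OF a n, folded c_def R_def] by blast
  obtain q where q: "q > 0" and Q: "\<forall>\<^sub>F lam in at_top. \<exists>Q. Q holomorphic_on ball c (2 * R) \<and>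
      (\<forall>u. scaled_F a (e lam) u = (u - \<zeta> lam) * Q u) \<and> (\<forall>u\<in>cball c R. q \<le> cmod (Q u))"
    by (rule simple_zero_factorization[OF R open_ball sub uniform_limit_scaled_F[OF e_lim] holo_e holo_0
          scaled_F_0_center[OF a n, folded c_def] deriv_scaled_F_0_center[OF a n, folded c_def]
          unique \<zeta>_lim zero])
  define B where "B = exp (sqrt (2 * T + T\<^sup>2) * a) / q"
  \<comment> \<open>Since 3/4 + 1/8 < 1, the disc of radius \<open>3 / 4 * R\<close> about the
    moving zero then stays inside the disc of radius \<open>R\<close> about
    \<open>c\<close>.\<close>
  have close: "\<forall>\<^sub>F lam in at_top. dist (\<zeta> lam) c < R / 8"
    by (rule tendstoD[OF \<zeta>_lim]) (use R in simp)
  have "\<forall>\<^sub>F lam in at_top. \<forall>x\<in>{-a..a}. \<exists>P S. open S \<and>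
    cball (resonance a lam n) (3 / 4 * R / sqrt (2 * lam)) \<subseteq> S \<and> P holomorphic_on S \<and>
    (\<forall>k\<in>S. cmod (P k) \<le> B / sqrt (2 * lam)) \<and>
    (\<forall>k\<in>S. phase_phi a lam x k = P k / (k - resonance a lam n))"
    using e_lt Q close
  proof eventually_elim
    case (elim lam)
    define b where "b = sqrt (2 * lam)"
    define z where "z = resonance a lam n"
    have b: "b > 0" using elim(1) by (simp add: b_def)
    have eb: "e lam = 1 / b" by (simp add: e_def b_def)
    obtain Q where Q: "Q holomorphic_on ball c (2 * R)"
        "\<And>u. scaled_F a (e lam) u = (u - \<zeta> lam) * Q u" "\<And>u. u \<in> cball c R \<Longrightarrow> q \<le> cmod (Q u)"
      using elim(2) by blast
    define v where "v = (\<lambda>k :: complex. of_real b * (k - of_real b))"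
    have v_diff: "v k - \<zeta> lam = of_real b * (k - z)" for k
      by (simp add: v_def \<zeta>_def z_def b_def algebra_simps)
    define S where "S = v -` ball c R"
    have openS: "open S"
      unfolding S_def v_def by (intro open_vimage open_ball continuous_intros)
    have subS: "cball z (3 / 4 * R / b) \<subseteq> S"
    proof
      fix k assume "k \<in> cball z (3 / 4 * R / b)"
      then have "cmod (k - z) * b \<le> 3 / 4 * R"
        using b by (simp add: dist_norm norm_minus_commute pos_le_divide_eq)
      then have "cmod (v k - \<zeta> lam) \<le> 3 / 4 * R"
        unfolding v_diff using b by (simp add: norm_mult mult.commute)
      then show "k \<in> S"
        using norm_triangle_ineq[of "v k - \<zeta> lam" "\<zeta> lam - c"] elim(3) R
        by (simp add: S_def dist_norm norm_minus_commute)
    qed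
    have Q_S: "q \<le> cmod (Q (v k))" if "k \<in> S" for k using that Q(3) by (auto simp: S_def)
    then have Q_nz: "Q (v k) \<noteq> 0" if "k \<in> S" for k using that q by fastforce
    have hv: "v holomorphic_on S" unfolding v_def by (intro holomorphic_intros)
    have hQ: "(\<lambda>k. Q (v k)) holomorphic_on S"
      by (rule holomorphic_on_compose_gen[OF hv Q(1), unfolded o_def]) (use R in \<open>auto simp: S_def\<close>)
    have lam: "lam > 0" using elim(1) by simp
    show ?case
    proof
      fix x assume x: "x \<in> {-a..a}"
      define N where "N = (\<lambda>k. cos (csqrt (2 * v k + of_real ((e lam)\<^sup>2) * (v k)\<^sup>2) * of_real x))"
      define P where "P = (\<lambda>k. N k / (of_real (sqrt pi) * Q (v k)) / of_real b)"
      have "(\<lambda>k. 2 * v k + of_real ((e lam)\<^sup>2) * (v k)\<^sup>2) holomorphic_on S"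
        by (intro holomorphic_intros hv)
      from holomorphic_on_compose_gen[OF this holomorphic_cos_csqrt, of "of_real x"]
      have hN: "N holomorphic_on S" by (simp add: N_def o_def)
      have "P holomorphic_on S"
        unfolding P_def using b Q_nz by (intro holomorphic_intros hN hQ) auto
      moreover have "cmod (P k) \<le> B / b" if k: "k \<in> S" for k
      proof -
        have "cmod (v k) \<le> T"
          using k norm_triangle_sub[of "v k" c] R by (simp add: S_def T_def dist_norm norm_minus_commute)
        then have "cmod (N k) \<le> exp (sqrt (2 * T + T\<^sup>2) * a)"
          unfolding N_def using elim(1) x by (intro norm_cos_csqrt_le) auto
        moreover have "1 * q \<le> sqrt pi * cmod (Q (v k))"
          using Q_S[OF k] q pi_gt3 by (intro mult_mono) auto
        ultimately have "cmod (N k) / (sqrt pi * cmod (Q (v k))) \<le> B"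
          unfolding B_def using q by (intro frac_le) auto
        from divide_right_mono[OF this, of b] show ?thesis
          using b by (simp add: P_def norm_divide norm_mult)
      qed
      \<comment> \<open>At \<open>k = z\<close> both sides are 0, by division by zero.\<close>
      moreover have "phase_phi a lam x k = P k / (k - z)" for k
      proof -
        have "ktilde lam k = csqrt (2 * v k + of_real ((e lam)\<^sup>2) * (v k)\<^sup>2)"
          using ktilde_scaled[OF lam, of k] by (simp only: v_def b_def eb)
        moreover have "F a lam k = of_real b * (k - z) * Q (v k)"
          using F_scaled[OF lam, of a k] Q(2)[of "v k"] by (simp only: v_diff) (simp only: v_def b_def eb)
        ultimately show ?thesis
          unfolding phase_phi_eq P_def N_def by (simp add: mult_ac del: csqrt.simps)
      qed
      ultimately show "\<exists>P S. open S \<and> cball (resonance a lam n) (3 / 4 * R / sqrt (2 * lam)) \<subseteq> S \<and>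
          P holomorphic_on S \<and> (\<forall>k\<in>S. cmod (P k) \<le> B / sqrt (2 * lam)) \<and>
          (\<forall>k\<in>S. phase_phi a lam x k = P k / (k - resonance a lam n))"
        using openS subS unfolding b_def[symmetric] z_def[symmetric] by blast
    qed
  qed
  moreover have "B > 0" using q by (simp add: B_def)
  ultimately show thesis using that by blast
qed

section \<open>Bounds for the Laurent coefficients and the remainder\<close>

theorem theorem1:
  fixes a :: real and n :: nat
  assumes "a > 0" and "n \<ge> 1" and "odd n"
  shows
    "(\<exists>\<Lambda>>0. \<forall>lam\<ge>\<Lambda>. real n < n_max lam \<longrightarrow>
        (\<forall>x\<in>{-a..a}.
           (\<lambda>w. phase_phi a lam x (resonance a lam n + w))
              has_laurent_expansion laurent_series a lam n x \<and>
           (\<forall>m. m < - 1 \<longrightarrow> laurent_coeff a lam n m x = 0) \<and>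
           (\<forall>k\<in>window a lam n.
              summable (R0_term a lam n (of_real k) x) \<and>
              phase_phi a lam x (of_real k) =
                laurent_coeff a lam n (-1) x / (of_real k - resonance a lam n)
                + laurent_coeff a lam n 0 x
                + R0 a lam n (of_real k) x)))
     \<and> (\<forall>m::int. m \<ge> - 1 \<longrightarrow> (\<exists>C::real. \<forall>\<^sub>F lam in at_top. \<forall>x\<in>{-a..a}.
           cmod (laurent_coeff a lam n m x) \<le> C * lam powr (of_int m / 2)))
     \<and> (\<exists>C::real. \<forall>\<^sub>F lam in at_top. \<forall>k\<in>window a lam n. \<forall>x\<in>{-a..a}.
           cmod (R0 a lam n (of_real k) x)
             \<le> C * lam powr (1 / 2) * cmod (of_real k - resonance a lam n))"
proof -
  define R where "R = real n * pi\<^sup>2 / (4 * a\<^sup>2)"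
  \<comment> \<open>The rescaled window lies within \<open>R / 2\<close>, that is two thirds of
    \<open>r\<close>; the remaining third gives the factor 3 in the bound for
    \<open>R0\<close>.\<close>
  define r where "r = 3 / 4 * R"
  have r: "r > 0" using assms by (simp add: r_def R_def)
  obtain B where B: "B > 0" and near: "\<forall>\<^sub>F lam in at_top. \<forall>x\<in>{-a..a}. \<exists>P S. open S \<and>
    cball (resonance a lam n) (r / sqrt (2 * lam)) \<subseteq> S \<and> P holomorphic_on S \<and>
    (\<forall>k\<in>S. cmod (P k) \<le> B / sqrt (2 * lam)) \<and>
    (\<forall>k\<in>S. phase_phi a lam x k = P k / (k - resonance a lam n))"
    using phase_phi_near_resonance[OF assms(1,3), folded R_def, folded r_def] by blast
  have ev: "\<forall>\<^sub>F lam in at_top. lam > 0 \<and> (\<forall>x\<in>{-a..a}.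
      (\<lambda>w. phase_phi a lam x (resonance a lam n + w)) has_laurent_expansion laurent_series a lam n x \<and>
      (\<forall>m. m < - 1 \<longrightarrow> laurent_coeff a lam n m x = 0) \<and>
      (\<forall>k\<in>window a lam n. summable (R0_term a lam n (of_real k) x) \<and>
         phase_phi a lam x (of_real k) =
           laurent_coeff a lam n (-1) x / (of_real k - resonance a lam n)
           + laurent_coeff a lam n 0 x + R0 a lam n (of_real k) x \<and>
         cmod (R0 a lam n (of_real k) x) \<le> 3 * B / r\<^sup>2 * sqrt (2 * lam) * cmod (of_real k - resonance a lam n)) \<and>
      (\<forall>j. cmod (laurent_coeff a lam n (int j - 1) x) \<le> B / r ^ j * (sqrt (2 * lam) ^ j / sqrt (2 * lam))))"
    (is "\<forall>\<^sub>F lam in at_top. ?P lam")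
    using near window_eventually_close[OF assms(1,2)]
      eventually_small[of a "real n * pi / 2 + pi + 1"]
  proof eventually_elim
    case (elim lam)
    define b where "b = sqrt (2 * lam)"
    define z where "z = resonance a lam n"
    have b: "b > 0" using elim(3) by (simp add: b_def)
    have "is_resonance a lam n z"
      unfolding z_def using resonance_is_resonance assms elim(3) by blast
    \<comment> \<open>The resonance is not real, so no point of the window is the pole
      itself.\<close>
    then have Im: "Im z < 0" by (simp add: is_resonance_def)
    have win: "cmod (of_real k - z) \<le> 2 / 3 * (r / b)" if "k \<in> window a lam n" for k
    proof -
      have "b * cmod (of_real k - z) \<le> 2 / 3 * r"
        using elim(2) that by (simp add: b_def z_def r_def R_def)
      then show ?thesis using b by (simp add: field_simps)
    qed
    have rb: "0 < r / b" using r b by simp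
    {
      fix x assume x: "x \<in> {-a..a}"
      obtain P S where PS: "open S" "cball z (r / b) \<subseteq> S" "P holomorphic_on S"
          "\<And>k. k \<in> S \<Longrightarrow> cmod (P k) \<le> B / b" "\<And>k. k \<in> S \<Longrightarrow> phase_phi a lam x k = P k / (k - z)"
        using bspec[OF elim(1) x] unfolding b_def[symmetric] z_def[symmetric] by blast
      have bound: "\<forall>k\<in>cball z (r / b). cmod (P k) \<le> B / b"
        and quot: "\<forall>k\<in>cball z (r / b) - {z}. phase_phi a lam x k = P k / (k - z)"
        using PS by blast+
      note L = simple_pole_laurent[OF PS(1,2) rb PS(3) bound quot]
      have coeff: "fls_nth (laurent_expansion (phase_phi a lam x) z) m = laurent_coeff a lam n m x" for m
        by (simp add: laurent_coeff_def laurent_series_def z_def)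
      have R0_term: "(\<lambda>j. laurent_coeff a lam n (int (Suc j)) x * (k - z) ^ Suc j) = R0_term a lam n k x" for k
        by (simp add: R0_term_def z_def fun_eq_iff)
      note L = L[unfolded coeff R0_term R0_def[symmetric]]
      have "(\<lambda>w. phase_phi a lam x (z + w)) has_laurent_expansion laurent_series a lam n x"
        using L(1) by (simp add: laurent_series_def z_def)
      moreover have "\<forall>m. m < - 1 \<longrightarrow> laurent_coeff a lam n m x = 0" using L(2) by blast
      moreover have "\<forall>j. cmod (laurent_coeff a lam n (int j - 1) x) \<le> B / r ^ j * (b ^ j / b)"
        using L(3) by (simp add: power_divide mult.commute)
      moreover have "\<forall>k\<in>window a lam n. summable (R0_term a lam n (of_real k) x) \<and>
         phase_phi a lam x (of_real k) =
           laurent_coeff a lam n (-1) x / (of_real k - z)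
           + laurent_coeff a lam n 0 x + R0 a lam n (of_real k) x \<and>
         cmod (R0 a lam n (of_real k) x) \<le> 3 * B / r\<^sup>2 * b * cmod (of_real k - z)"
      proof (intro ballI conjI)
        fix k assume k: "k \<in> window a lam n"
        have kb: "complex_of_real k \<in> ball z (r / b)"
          using win[OF k] rb by (simp add: dist_norm norm_minus_commute)
        have kz: "complex_of_real k \<noteq> z" using Im by auto
        show "summable (R0_term a lam n (of_real k) x)" using L(4)[OF kb] .
        show "phase_phi a lam x (of_real k) = laurent_coeff a lam n (-1) x / (of_real k - z)
           + laurent_coeff a lam n 0 x + R0 a lam n (of_real k) x" using L(5)[OF kb kz] .
        have "cmod (R0 a lam n (of_real k) x) \<le>
            B / b / (r / b) * cmod (of_real k - z) / (r / b - cmod (of_real k - z))"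
          using L(6)[OF kb] .
        \<comment> \<open>The distance to the boundary of the disc is at least r / (3 * b). The
          factors 1 / b of \<open>P\<close> and 1 / b of the radius leave one power of b in the
          numerator.\<close>
        also have "\<dots> \<le> B / b / (r / b) * cmod (of_real k - z) / (1 / 3 * (r / b))"
        proof (rule divide_left_mono)
          have gap: "1 / 3 * (r / b) \<le> r / b - cmod (of_real k - z)" using win[OF k] by linarith
          then show "1 / 3 * (r / b) \<le> r / b - cmod (of_real k - z)" .
          have "0 < r / b - cmod (of_real k - z)" using gap rb by linarith
          then show "0 < (r / b - cmod (of_real k - z)) * (1 / 3 * (r / b))" using rb by (intro mult_pos_pos) auto
        qed (use B b r in simp)
        also have "\<dots> = 3 * B / r\<^sup>2 * b * cmod (of_real k - z)"
          using b r by (simp add: field_simps power2_eq_square)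
        finally show "cmod (R0 a lam n (of_real k) x) \<le> 3 * B / r\<^sup>2 * b * cmod (of_real k - z)" .
      qed
      ultimately have "(\<lambda>w. phase_phi a lam x (z + w)) has_laurent_expansion laurent_series a lam n x \<and>
        (\<forall>m. m < - 1 \<longrightarrow> laurent_coeff a lam n m x = 0) \<and>
        (\<forall>k\<in>window a lam n. summable (R0_term a lam n (of_real k) x) \<and>
         phase_phi a lam x (of_real k) =
           laurent_coeff a lam n (-1) x / (of_real k - z)
           + laurent_coeff a lam n 0 x + R0 a lam n (of_real k) x \<and>
         cmod (R0 a lam n (of_real k) x) \<le> 3 * B / r\<^sup>2 * b * cmod (of_real k - z)) \<and>
        (\<forall>j. cmod (laurent_coeff a lam n (int j - 1) x) \<le> B / r ^ j * (b ^ j / b))"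
        by blast
    }
    note core = this[unfolded b_def z_def]
    have "lam > 0" using elim(3) by blast
    then show ?case by (rule conjI[OF _ ballI]) (rule core)
  qed
  have sqrt_eq: "sqrt (2 * lam) = sqrt 2 * lam powr (1 / 2)" if "lam > 0" for lam :: real
    using that by (simp add: real_sqrt_mult powr_half_sqrt)
  have part1: "\<exists>\<Lambda>>0. \<forall>lam\<ge>\<Lambda>. real n < n_max lam \<longrightarrow>
        (\<forall>x\<in>{-a..a}.
           (\<lambda>w. phase_phi a lam x (resonance a lam n + w))
              has_laurent_expansion laurent_series a lam n x \<and>
           (\<forall>m. m < - 1 \<longrightarrow> laurent_coeff a lam n m x = 0) \<and>
           (\<forall>k\<in>window a lam n.
              summable (R0_term a lam n (of_real k) x) \<and>
              phase_phi a lam x (of_real k) =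
                laurent_coeff a lam n (-1) x / (of_real k - resonance a lam n)
                + laurent_coeff a lam n 0 x
                + R0 a lam n (of_real k) x))"
  proof -
    from eventually_at_top_linorder[THEN iffD1, OF ev]
    obtain \<Lambda> where "\<forall>lam\<ge>\<Lambda>. ?P lam" by (rule exE)
    note \<Lambda> = this[THEN spec, THEN mp]
    show ?thesis
    proof (intro exI[of _ \<Lambda>] conjI allI impI ballI)
      \<comment> \<open>The positivity clause of the eventual statement, taken at the threshold
        itself.\<close>
      show "\<Lambda> > 0" using \<Lambda>[OF order_refl] by (rule conjunct1)
    next
      fix lam x assume "lam \<ge> \<Lambda>" and x: "x \<in> {-a..a}"
      note * = bspec[OF conjunct2[OF \<Lambda>[OF this(1)]] x]
      show "(\<lambda>w. phase_phi a lam x (resonance a lam n + w)) has_laurent_expansion laurent_series a lam n x"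
        using * by (elim conjE)
      show "laurent_coeff a lam n m x = 0" if "m < - 1" for m
        using * that by (elim conjE allE[of _ m] impE)
      fix k assume "k \<in> window a lam n"
      with * show "summable (R0_term a lam n (of_real k) x)"
        "phase_phi a lam x (of_real k) = laurent_coeff a lam n (-1) x / (of_real k - resonance a lam n)
           + laurent_coeff a lam n 0 x + R0 a lam n (of_real k) x"
        by (auto dest: bspec[where x = k])
    qed
  qed
  have part2: "\<exists>C::real. \<forall>\<^sub>F lam in at_top. \<forall>x\<in>{-a..a}.
      cmod (laurent_coeff a lam n m x) \<le> C * lam powr (of_int m / 2)" if m: "m \<ge> - 1" for m :: int
  proof -
    \<comment> \<open>The Laurent index \<open>m\<close> belongs to the Taylor index
      \<open>m + 1\<close> of the numerator, hence the order b^(j - 1) = b^m.\<close>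
    define j where "j = nat (m + 1)"
    have mj: "m = int j - 1" using m by (simp add: j_def)
    have pow: "sqrt (2 * lam) ^ j / sqrt (2 * lam) = 2 powr (m / 2) * lam powr (m / 2)" if "lam > 0" for lam :: real
    proof -
      have "sqrt (2 * lam) ^ j / sqrt (2 * lam) = sqrt (2 * lam) powr m"
        using that by (simp add: mj powr_diff powr_realpow)
      also have "\<dots> = (2 * lam) powr (m / 2)"
        using that by (simp add: powr_powr flip: powr_half_sqrt)
      finally show ?thesis using that by (simp add: powr_mult)
    qed
    have "\<forall>\<^sub>F lam in at_top. \<forall>x\<in>{-a..a}.
        cmod (laurent_coeff a lam n m x) \<le> B / r ^ j * 2 powr (m / 2) * lam powr (m / 2)"
      using ev
    proof eventually_elim
      case (elim lam)
      then have "\<forall>x\<in>{-a..a}. cmod (laurent_coeff a lam n m x) \<le> B / r ^ j * (sqrt (2 * lam) ^ j / sqrt (2 * lam))"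
        unfolding mj by blast
      then show ?case using pow[of lam] elim by (simp only: mult.assoc)
    qed
    then show ?thesis by blast
  qed
  have part3: "\<exists>C::real. \<forall>\<^sub>F lam in at_top. \<forall>k\<in>window a lam n. \<forall>x\<in>{-a..a}.
      cmod (R0 a lam n (of_real k) x) \<le> C * lam powr (1 / 2) * cmod (of_real k - resonance a lam n)"
  proof (intro exI)
    show "\<forall>\<^sub>F lam in at_top. \<forall>k\<in>window a lam n. \<forall>x\<in>{-a..a}.
      cmod (R0 a lam n (of_real k) x)
        \<le> 3 * B / r\<^sup>2 * sqrt 2 * lam powr (1 / 2) * cmod (of_real k - resonance a lam n)"
      using ev
    proof eventually_elim
      case (elim lam)
      then have "\<forall>k\<in>window a lam n. \<forall>x\<in>{-a..a}. cmod (R0 a lam n (of_real k) x)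
          \<le> 3 * B / r\<^sup>2 * sqrt (2 * lam) * cmod (of_real k - resonance a lam n)" by blast
      then show ?case using sqrt_eq[of lam] elim by (simp only: mult.assoc)
    qed
  qed
  show ?thesis using part1 part2 part3 by blast
qed

end
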